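(* Let $\rho>0$ and let $u$ be a $C^{1,1}$ convex function on $B(O,\rho)\subseteq\mathbb{R}^2$ satisfying the Monge-Ampère equation $$\det(D^2u)=k\quad\text{in } B(O,\rho),$$ where $k\geq 0$ in $B(O,\rho)\setminus\{O\}$ and $k\in C^3(B(O,\rho))$. Assume in addition that $u=\Phi(\sqrt{x^2+y^2})$ for some function $\Phi$ of one variable. Then $u\in C^{2,1}(B(O,\rho))$.
   Context: $B(O,\rho)$ is the open ball in $\mathbb{R}^2$ of radius $\rho$ centred at the origin $O$. Since $u$ is $C^{1,1}$, its Hessian $D^2u$ exists almost everywhere, and the equation is understood almost everywhere. $C^{k,1}$ denotes functions with derivatives up to order $k$ which are Lipschitz; on an open set $\Omega$, membership in $C^{k,1}(\Omega)$ is understood locally, i.e. the $k$-th order derivatives are Lipschitz on compact subsets of $\Omega$. *)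

theory Defs
  imports "HOL-Analysis.Analysis"
begin

definition partial_deriv :: "'n::finite \<Rightarrow> (real^'n \<Rightarrow> real) \<Rightarrow> real^'n \<Rightarrow> real" where
  "partial_deriv i f x = frechet_derivative f (at x) (axis i 1)"

definition grad :: "(real^'n::finite \<Rightarrow> real) \<Rightarrow> real^'n \<Rightarrow> real^'n" where
  "grad f x = (\<chi> i. partial_deriv i f x)"

text \<open>Only meaningful at points where \<open>grad f\<close> is differentiable, because
  \<^const>\<open>frechet_derivative\<close> is a total function.\<close>

definition hessian :: "(real^'n::finite \<Rightarrow> real) \<Rightarrow> real^'n \<Rightarrow> real^'n^'n" where
  "hessian f x = matrix (frechet_derivative (grad f) (at x))"

text \<open>\<open>C\<^sup>m(S)\<close> for open \<open>S\<close>. A function with continuous partial derivatives is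
  differentiable, so requiring Frechet differentiability at each stage excludes nothing.\<close>

primrec Ck_on :: "nat \<Rightarrow> (real^'n::finite) set \<Rightarrow> (real^'n \<Rightarrow> real) \<Rightarrow> bool" where
  "Ck_on 0 S f \<longleftrightarrow> continuous_on S f"
| "Ck_on (Suc m) S f \<longleftrightarrow>
     (\<forall>x\<in>S. f differentiable (at x)) \<and> (\<forall>i. Ck_on m S (partial_deriv i f))"

text \<open>\<open>C\<^bsup>m,1\<^esup>(S)\<close> for open \<open>S\<close>, understood locally: the \<open>m\<close>-th order partial derivatives are
  Lipschitz on every compact subset of \<open>S\<close>. The lower-order derivatives then are so as well.\<close>

primrec Ck1_on :: "nat \<Rightarrow> (real^'n::finite) set \<Rightarrow> (real^'n \<Rightarrow> real) \<Rightarrow> bool" where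
  "Ck1_on 0 S f \<longleftrightarrow> (\<forall>K. compact K \<and> K \<subseteq> S \<longrightarrow> (\<exists>L. L-lipschitz_on K f))"
| "Ck1_on (Suc m) S f \<longleftrightarrow>
     (\<forall>x\<in>S. f differentiable (at x)) \<and> (\<forall>i. Ck1_on m S (partial_deriv i f))"

text \<open>The Monge--Ampere equation \<open>det (D\<^sup>2u) = k\<close> almost everywhere in \<open>S\<close>: at almost every
  point of \<open>S\<close> the Hessian exists and has the prescribed determinant.\<close>

definition monge_ampere_ae ::
    "(real^'n::finite) set \<Rightarrow> (real^'n \<Rightarrow> real) \<Rightarrow> (real^'n \<Rightarrow> real) \<Rightarrow> bool" where
  "monge_ampere_ae S u k \<longleftrightarrow>
     (AE x in lebesgue_on S. grad u differentiable (at x) \<and> det (hessian u x) = k x)"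

end

theory Submission imports Defs begin

text \<open>
  Write \<open>u = \<Phi> \<circ> norm\<close> and \<open>g = \<Phi>'\<close>. The gradient of \<open>u\<close> at \<open>x\<close> is \<open>g (norm x) / norm x\<close> times
  \<open>x\<close>, so the Hessian has eigenvalue \<open>g' (r)\<close> in the radial and \<open>g r / r\<close> in the tangential
  direction, where \<open>r = norm x\<close>. The equation \<open>det (D\<^sup>2u) = k\<close> thus reads
  \<open>(g\<^sup>2)' = 2 r k\<close>, and \<open>g\<close> is a continuous square root of the explicit nonnegative function
  \<open>f r = 2 \<integral>\<^sub>0\<^sup>r s \<kappa>(s) ds\<close>, where \<open>\<kappa>\<close> is \<open>k\<close> restricted to a ray. What has to be shown is that \<open>g\<close>
  is of class \<open>C\<^bsup>1,1\<^esup>\<close> up to \<open>r = 0\<close>; this gives \<open>u\<close> of class \<open>C\<^bsup>2,1\<^esup>\<close> (\<open>radial_profile_Ck1\<close>).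

  Square roots of smooth nonnegative functions need not be \<open>C\<^bsup>1,1\<^esup>\<close> when the function vanishes. Here two
  facts help: \<open>f\<close> is nondecreasing and has a bounded fourth derivative. If \<open>\<kappa> 0 > 0\<close>, then \<open>f\<close> is
  comparable to \<open>r\<^sup>2\<close> and the second derivative of \<open>g\<close> is bounded by direct computation
  (\<open>root_C11_if_quadratic\<close>). If \<open>\<kappa> 0 = 0\<close>, then \<open>\<kappa>\<close> has a minimum at \<open>0\<close>, so \<open>\<kappa> = O(r\<^sup>2)\<close> and
  \<open>f = O(r\<^sup>4)\<close>. On the interval to the left of \<open>r\<close> whose length is a small multiple of \<open>f(r)\<close> to the
  power \<open>1/4\<close>, which by \<open>f = O(r\<^sup>4)\<close> stays inside the domain, monotonicity gives \<open>0 \<le> f \<le> f r\<close>.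
  Interpolation between this bound and the one for the fourth derivative
  (\<open>landau_kolmogorov_left\<close>) yields \<open>f' = O(f\<^bsup>3/4\<^esup>)\<close> and \<open>f'' = O(f\<^bsup>1/2\<^esup>)\<close>, which is what bounds
  \<open>g'' = f'' / (2 g) - f'\<^sup>2 / (4 g\<^sup>3)\<close> (\<open>root_C11_if_quartic\<close>).

  The equation holds only almost everywhere in the plane, while the profile lives on a line. Instead
  of disintegrating Lebesgue measure in polar coordinates, a Sard argument shows that
  a locally Lipschitz \<open>\<phi>\<close> is constant if \<open>\<phi>' (norm x) = 0\<close> for almost every \<open>x\<close>
  (\<open>constant_of_radial_derivative_zero_ae\<close>); this is applied to \<open>\<phi> = g\<^sup>2 - f\<close>.
\<close>

section \<open>Continuous square roots of functions of one variable\<close>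

text \<open>
  A Landau--Kolmogorov inequality at the right end of an interval. Taylor's formula at the three points
  \<open>x - d\<close>, \<open>x - 2d\<close>, \<open>x - 3d\<close> gives three linear equations for
  \<open>F 1 x * d\<close>, \<open>F 2 x * d\<^sup>2\<close>, \<open>F 3 x * d ^ 3\<close> with bounded right-hand sides;
  solving them bounds the first two unknowns. All sample points lie on the left because the
  application controls \<open>F\<close> there by monotonicity.
\<close>

lemma landau_kolmogorov_left:
  fixes F :: "nat \<Rightarrow> real \<Rightarrow> real" and x d :: real
  assumes d: "0 < d"
    and der: "\<And>m t. m < 4 \<Longrightarrow> x - 3 * d \<le> t \<Longrightarrow> t \<le> x \<Longrightarrow> DERIV (F m) t :> F (Suc m) t"
    and top: "\<And>t. x - 3 * d \<le> t \<Longrightarrow> t \<le> x \<Longrightarrow> \<bar>F 4 t\<bar> \<le> M"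
    and bot: "\<And>t. x - 3 * d \<le> t \<Longrightarrow> t \<le> x \<Longrightarrow> \<bar>F 0 t\<bar> \<le> X"
  shows "\<bar>F 1 x\<bar> * d \<le> 40 * (X + M * d ^ 4)" and "\<bar>F 2 x\<bar> * d\<^sup>2 \<le> 40 * (X + M * d ^ 4)"
proof -
  define Y where "Y = M * d ^ 4"
  have M0: "0 \<le> M" using top[of x] d by auto
  have taylor: "\<bar>- (i * (F 1 x * d)) + i\<^sup>2 / 2 * (F 2 x * d\<^sup>2) - i ^ 3 / 6 * (F 3 x * d ^ 3)\<bar>
      \<le> 2 * X + 4 * Y" if i: "0 < i" "i \<le> 3" for i
  proof -
    have id: "x - 3 * d \<le> x - i * d" "x - i * d < x" using i d by auto
    have "\<exists>t. x - i * d < t \<and> t < x \<and> F 0 (x - i * d) =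
        (\<Sum>m<4. F m x / fact m * (x - i * d - x) ^ m) + F 4 t / fact 4 * (x - i * d - x) ^ 4"
      using Taylor_down[of 4 F "F 0" "x - i * d" x x] der id by auto
    then obtain t where t: "x - i * d < t" "t < x" and eq: "F 0 (x - i * d) =
        (\<Sum>m<4. F m x / fact m * (- (i * d)) ^ m) + F 4 t / fact 4 * (- (i * d)) ^ 4"
      by auto
    have "\<bar>F 4 t\<bar> * (i * d) ^ 4 \<le> M * (3 * d) ^ 4"
      using t id i d top[of t] M0 by (intro mult_mono power_mono zero_le_power mult_nonneg_nonneg) linarith+
    then have "\<bar>F 4 t * (i * d) ^ 4\<bar> \<le> 81 * Y"
      by (simp add: Y_def abs_mult power_mult_distrib)
    moreover have "- (i * (F 1 x * d)) + i\<^sup>2 / 2 * (F 2 x * d\<^sup>2) - i ^ 3 / 6 * (F 3 x * d ^ 3)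
      = F 0 (x - i * d) - F 0 x - F 4 t * (i * d) ^ 4 / 24"
      unfolding eq by (simp add: eval_nat_numeral field_simps)
    moreover have "0 \<le> Y" using M0 by (simp add: Y_def)
    ultimately show ?thesis
      using bot[of "x - i * d"] bot[of x] id d by (simp; linarith)
  qed
  define Z where "Z = 2 * X + 4 * Y"
  define p where "p i = - (i * (F 1 x * d)) + i\<^sup>2 / 2 * (F 2 x * d\<^sup>2) - i ^ 3 / 6 * (F 3 x * d ^ 3)"
    for i :: real
  have p: "\<bar>p 1\<bar> \<le> Z" "\<bar>p 2\<bar> \<le> Z" "\<bar>p 3\<bar> \<le> Z"
    using taylor[of 1] taylor[of 2] taylor[of 3] unfolding p_def Z_def by simp_all
  have "0 \<le> X" using bot[of x] d by auto
  moreover have "0 \<le> Y" using M0 by (simp add: Y_def)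
  ultimately have Z: "10 * Z \<le> 40 * (X + Y)" "5 * Z \<le> 40 * (X + Y)" by (simp_all add: Z_def)
  \<comment> \<open>The coefficients solve the 3 by 3 linear system given by the definition of \<open>p\<close>.\<close>
  have "F 1 x * d = - 3 * p 1 + 3/2 * p 2 - 1/3 * p 3"
    and "F 2 x * d\<^sup>2 = - 5 * p 1 + 4 * p 2 - p 3"
    by (simp_all add: p_def algebra_simps)
  then have "\<bar>F 1 x * d\<bar> \<le> 5 * Z" "\<bar>F 2 x * d\<^sup>2\<bar> \<le> 10 * Z"
    using p by linarith+
  then have "\<bar>F 1 x * d\<bar> \<le> 40 * (X + Y)" "\<bar>F 2 x * d\<^sup>2\<bar> \<le> 40 * (X + Y)"
    using Z by linarith+
  then show "\<bar>F 1 x\<bar> * d \<le> 40 * (X + M * d ^ 4)" "\<bar>F 2 x\<bar> * d\<^sup>2 \<le> 40 * (X + M * d ^ 4)"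
    using d by (simp_all add: Y_def abs_mult)
qed

text \<open>
  No sign of \<open>g\<close> is fixed: a continuous root keeps its sign near a point where it does not vanish.
\<close>

lemma DERIV_root:
  fixes f g :: "real \<Rightarrow> real"
  assumes f: "DERIV f x :> D" and g: "isCont g x" and sq: "\<forall>\<^sub>F t in nhds x. (g t)\<^sup>2 = f t"
    and nz: "g x \<noteq> 0"
  shows "DERIV g x :> D / (2 * g x)"
proof -
  have "g x + g x \<noteq> 0" using nz by simp
  then have "((\<lambda>t. ((f t - f x) / (t - x)) / (g t + g x)) \<longlongrightarrow> D / (g x + g x)) (at x)"
    by (intro tendsto_divide tendsto_add tendsto_const
        f[unfolded has_field_derivative_iff] g[unfolded continuous_at])
  moreover have "\<forall>\<^sub>F t in at x. ((f t - f x) / (t - x)) / (g t + g x) = (g t - g x) / (t - x)"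
  proof -
    have "\<forall>\<^sub>F t in at x. g t + g x \<noteq> 0"
      by (rule tendsto_imp_eventually_ne[OF tendsto_add[OF g[unfolded continuous_at]
              tendsto_const[of "g x"]]]) (use nz in simp)
    moreover have "\<forall>\<^sub>F t in at x. (g t)\<^sup>2 = f t"
      using sq by (simp add: eventually_nhds_conv_at)
    ultimately show ?thesis
    proof eventually_elim
      case (elim t)
      have "(g x)\<^sup>2 = f x" using sq by (simp add: eventually_nhds_conv_at)
      then have "f t - f x = (g t - g x) * (g t + g x)"
        using elim(2) by (simp add: algebra_simps power2_eq_square)
      then show ?case using elim(1) by simp
    qed
  qed
  ultimately show ?thesis
    unfolding has_field_derivative_iff mult_2 by (rule Lim_transform_eventually)
qed

lemma DERIV_half_quotient:
  fixes f1 f2 g :: "real \<Rightarrow> real"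
  assumes f1: "DERIV f1 t :> f2 t" and g: "DERIV g t :> f1 t / (2 * g t)"
    and nz: "g t \<noteq> 0"
  shows "DERIV (\<lambda>s. f1 s / (2 * g s)) t :> f2 t / (2 * g t) - (f1 t)\<^sup>2 / (4 * g t ^ 3)"
  by (rule derivative_eq_intros f1 g refl | use nz in \<open>simp add: field_simps eval_nat_numeral\<close>)+

text \<open>
  The choice \<open>d = e / (6 A)\<close>, with \<open>e\<close> the fourth root of \<open>F 0 x\<close>, balances the two terms
  \<open>F 0 x\<close> and \<open>A d\<^sup>4\<close> of the interpolation inequality. The quartic bound means \<open>e \<le> A x\<close>, so the interval
  of length \<open>3 d\<close> to the left of \<open>x\<close> does not reach \<open>0\<close>.
\<close>

lemma quartic_root_bounds:
  fixes F :: "nat \<Rightarrow> real \<Rightarrow> real" and g :: "real \<Rightarrow> real" and A x :: real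
  assumes x: "0 < x" and A: "1 \<le> A"
    and der: "\<And>m t. m < 4 \<Longrightarrow> 0 < t \<Longrightarrow> t \<le> x \<Longrightarrow> DERIV (F m) t :> F (Suc m) t"
    and mono: "\<And>t. 0 < t \<Longrightarrow> t \<le> x \<Longrightarrow> 0 \<le> F 0 t \<and> F 0 t \<le> F 0 x"
    and top: "\<And>t. 0 < t \<Longrightarrow> t \<le> x \<Longrightarrow> \<bar>F 4 t\<bar> \<le> A"
    and quartic: "F 0 x \<le> A * x ^ 4"
    and root: "(g x)\<^sup>2 = F 0 x" and nz: "g x \<noteq> 0"
  defines "e \<equiv> sqrt \<bar>g x\<bar>"
  shows "0 < e" "\<bar>g x\<bar> = e\<^sup>2" "F 0 x = e ^ 4"
    "\<bar>F 1 x\<bar> \<le> 480 * A * e ^ 3" "\<bar>F 2 x\<bar> \<le> 2880 * A\<^sup>2 * e\<^sup>2"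
proof -
  show e0: "0 < e" and g: "\<bar>g x\<bar> = e\<^sup>2" using nz by (simp_all add: e_def)
  have "F 0 x = \<bar>g x\<bar>\<^sup>2" using root by simp
  then show F: "F 0 x = e ^ 4" by (simp add: g)
  have "A * x ^ 4 \<le> A ^ 4 * x ^ 4"
    using A x by (intro mult_right_mono self_le_power) auto
  then have "e ^ 4 \<le> (A * x) ^ 4" using quartic F by (simp add: power_mult_distrib)
  then have eA: "e \<le> A * x" using A x power_mono_iff[of e "A * x" 4] e0 by simp
  define d where "d = e / (6 * A)"
  have d: "0 < d" using e0 A by (simp add: d_def)
  have ed: "e = 6 * A * d" using A by (simp add: d_def)
  have "6 * d \<le> x" using eA A by (simp add: ed)
  then have dx: "0 < x - 3 * d" using x by simp
  have bound: "e ^ 4 + A * d ^ 4 \<le> 2 * e ^ 4"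
  proof -
    have "A * d ^ 4 \<le> (6 * A) ^ 4 * d ^ 4"
      using A d self_le_power[of A 4] by (intro mult_right_mono) (auto simp: power_mult_distrib)
    then show ?thesis by (simp add: ed power_mult_distrib)
  qed
  have lk: "\<bar>F 1 x\<bar> * d \<le> 40 * (e ^ 4 + A * d ^ 4)" "\<bar>F 2 x\<bar> * d\<^sup>2 \<le> 40 * (e ^ 4 + A * d ^ 4)"
  proof -
    have pos: "0 < t" if "x - 3 * d \<le> t" for t using that dx by linarith
    have "\<bar>F 0 t\<bar> \<le> e ^ 4" if "x - 3 * d \<le> t" "t \<le> x" for t
      using mono[OF pos[OF that(1)] that(2)] F by simp
    then show "\<bar>F 1 x\<bar> * d \<le> 40 * (e ^ 4 + A * d ^ 4)"
      "\<bar>F 2 x\<bar> * d\<^sup>2 \<le> 40 * (e ^ 4 + A * d ^ 4)"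
      using landau_kolmogorov_left[of d x F A "e ^ 4"] d der[OF _ pos] top[OF pos] by auto
  qed
  have "\<bar>F 1 x\<bar> * d \<le> 80 * e ^ 4" by (rule order_trans[OF lk(1)]) (use bound in simp)
  also have "\<dots> = 480 * A * e ^ 3 * d" by (simp add: ed eval_nat_numeral)
  finally show "\<bar>F 1 x\<bar> \<le> 480 * A * e ^ 3" using d by simp
  have "\<bar>F 2 x\<bar> * d\<^sup>2 \<le> 80 * e ^ 4" by (rule order_trans[OF lk(2)]) (use bound in simp)
  also have "\<dots> = 2880 * A\<^sup>2 * e\<^sup>2 * d\<^sup>2" by (simp add: ed eval_nat_numeral)
  finally show "\<bar>F 2 x\<bar> \<le> 2880 * A\<^sup>2 * e\<^sup>2" using d by simp
qed

lemma DERIV_zero_on_interval: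
  fixes f :: "real \<Rightarrow> real"
  assumes "DERIV f x :> D" "a < x" "x < b" "\<And>t. a < t \<Longrightarrow> t < b \<Longrightarrow> f t = 0"
  shows "D = 0"
proof -
  have "DERIV f x :> 0"
    by (rule has_field_derivative_transform_within_open[of "\<lambda>_. 0" 0 x "{a<..<b}"])
      (use assms in auto)
  then show ?thesis using assms(1) DERIV_unique by blast
qed

text \<open>
  All derivatives up to order three vanish on \<open>(0, r)\<close>, so the Taylor expansion at a point \<open>c < r\<close>
  consists of its remainder only; then \<open>c\<close> tends to \<open>r\<close>. Expanding at \<open>c\<close> rather than at \<open>r\<close>
  avoids evaluating the derivatives at the boundary of the zero set.
\<close>

lemma vanishing_then_quartic:
  fixes F :: "nat \<Rightarrow> real \<Rightarrow> real"
  assumes der: "\<And>m t. m < 4 \<Longrightarrow> 0 < t \<Longrightarrow> t \<le> s \<Longrightarrow> DERIV (F m) t :> F (Suc m) t"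
    and top: "\<And>t. 0 < t \<Longrightarrow> t \<le> s \<Longrightarrow> \<bar>F 4 t\<bar> \<le> A"
    and zero: "\<And>t. 0 < t \<Longrightarrow> t \<le> r \<Longrightarrow> F 0 t = 0"
    and rs: "0 < r" "r < s"
  shows "F 0 s \<le> A * (s - r) ^ 4"
proof -
  have flat: "F m t = 0" if "m < 4" "0 < t" "t < r" for m t
    using that
  proof (induction m arbitrary: t)
    case 0 then show ?case using zero by simp
  next
    case (Suc m)
    show ?case
      by (rule DERIV_zero_on_interval[where f = "F m" and x = t and a = 0 and b = r]) (use Suc der rs in auto)
  qed
  have step: "F 0 s \<le> A * (s - c) ^ 4" if c: "0 < c" "c < r" for c
  proof -
    have "\<exists>t. c < t \<and> t < s \<and>
        F 0 s = (\<Sum>m<4. F m c / fact m * (s - c) ^ m) + F 4 t / fact 4 * (s - c) ^ 4"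
      using Taylor_up[of 4 F "F 0" c s c] der rs c by auto
    then obtain t where t: "c < t" "t < s"
      and eq: "F 0 s = (\<Sum>m<4. F m c / fact m * (s - c) ^ m) + F 4 t / fact 4 * (s - c) ^ 4"
      by blast
    have "F 0 s = F 4 t / 24 * (s - c) ^ 4"
      unfolding eq using flat c by (simp add: eval_nat_numeral)
    also have "\<dots> \<le> A * (s - c) ^ 4"
      using top[of t] t c by (intro mult_right_mono) auto
    finally show ?thesis .
  qed
  have "((\<lambda>c. A * (s - c) ^ 4) \<longlongrightarrow> A * (s - r) ^ 4) (at_left r)"
    by (intro tendsto_intros)
  moreover have "\<forall>\<^sub>F c in at_left r. F 0 s \<le> A * (s - c) ^ 4"
    using eventually_at_left_real[OF rs(1)] by eventually_elim (use step in auto)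
  ultimately show ?thesis
    by (rule tendsto_lowerbound) simp
qed

text \<open>
  The formula \<open>F 1 t / (2 * g t)\<close> is the derivative of \<open>g\<close> also where \<open>g\<close> vanishes, since division by
  zero yields \<open>0\<close>: the zero set of \<open>g\<close> is an initial interval by monotonicity, and beyond it \<open>F 0\<close>
  grows at most like a fourth power of the distance, hence \<open>g\<close> at most like a square. Between points
  where \<open>g\<close> does not vanish the Lipschitz bound comes from the estimates of
  \<open>quartic_root_bounds\<close>, inserted into the second derivative of \<open>g\<close>.
\<close>

lemma root_C11_if_quartic:
  fixes F :: "nat \<Rightarrow> real \<Rightarrow> real" and g :: "real \<Rightarrow> real" and \<rho> :: real
  assumes der: "\<And>m t. m < 4 \<Longrightarrow> 0 < t \<Longrightarrow> t < \<rho> \<Longrightarrow> DERIV (F m) t :> F (Suc m) t"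
    and incr: "\<And>t. 0 < t \<Longrightarrow> t < \<rho> \<Longrightarrow> 0 \<le> F 1 t"
    and root: "\<And>t. 0 < t \<Longrightarrow> t < \<rho> \<Longrightarrow> (g t)\<^sup>2 = F 0 t"
    and cont: "continuous_on {0<..<\<rho>} g"
    and bounds: "\<And>R. 0 < R \<Longrightarrow> R < \<rho> \<Longrightarrow>
      \<exists>M. \<forall>t. 0 < t \<and> t \<le> R \<longrightarrow> F 0 t \<le> M * t ^ 4 \<and> \<bar>F 4 t\<bar> \<le> M"
  shows "\<And>t. 0 < t \<Longrightarrow> t < \<rho> \<Longrightarrow> DERIV g t :> F 1 t / (2 * g t)"
    and "\<And>R. R < \<rho> \<Longrightarrow> \<exists>L. L-lipschitz_on {0<..R} (\<lambda>t. F 1 t / (2 * g t))"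
proof -
  have mono: "F 0 s \<le> F 0 t" if "0 < s" "s \<le> t" "t < \<rho>" for s t
    by (rule DERIV_nonneg_imp_nondecreasing[of s t "F 0"])
      (use that in \<open>auto intro!: exI der[of 0, simplified] incr[simplified]\<close>)
  have F0: "0 \<le> F 0 t" if "0 < t" "t < \<rho>" for t
    using root[OF that] by (metis zero_le_power2)
  have "\<exists>A\<ge>1. \<forall>t. 0 < t \<and> t \<le> R \<longrightarrow> F 0 t \<le> A * t ^ 4 \<and> \<bar>F 4 t\<bar> \<le> A"
    if R: "0 < R" "R < \<rho>" for R
  proof -
    obtain M where M: "\<And>t. 0 < t \<Longrightarrow> t \<le> R \<Longrightarrow> F 0 t \<le> M * t ^ 4 \<and> \<bar>F 4 t\<bar> \<le> M"
      using bounds[OF R] by blast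
    have "F 0 t \<le> max 1 M * t ^ 4 \<and> \<bar>F 4 t\<bar> \<le> max 1 M" if t: "0 < t" "t \<le> R" for t
    proof -
      have "M * t ^ 4 \<le> max 1 M * t ^ 4" by (intro mult_right_mono) (use t in auto)
      then show ?thesis using M[OF t] by linarith
    qed
    then show ?thesis by (intro exI[of _ "max 1 M"]) auto
  qed
  then have "\<forall>R\<in>{0<..<\<rho>}. \<exists>A. 1 \<le> A \<and> (\<forall>t. 0 < t \<and> t \<le> R \<longrightarrow> F 0 t \<le> A * t ^ 4 \<and> \<bar>F 4 t\<bar> \<le> A)"
    by simp
  from bchoice[OF this] obtain A where "\<forall>R\<in>{0<..<\<rho>}. 1 \<le> A R \<and>
      (\<forall>t. 0 < t \<and> t \<le> R \<longrightarrow> F 0 t \<le> A R * t ^ 4 \<and> \<bar>F 4 t\<bar> \<le> A R)"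
    by blast
  then have A: "\<And>R. 0 < R \<Longrightarrow> R < \<rho> \<Longrightarrow> 1 \<le> A R"
      "\<And>R t. 0 < R \<Longrightarrow> R < \<rho> \<Longrightarrow> 0 < t \<Longrightarrow> t \<le> R \<Longrightarrow> F 0 t \<le> A R * t ^ 4"
      "\<And>R t. 0 < R \<Longrightarrow> R < \<rho> \<Longrightarrow> 0 < t \<Longrightarrow> t \<le> R \<Longrightarrow> \<bar>F 4 t\<bar> \<le> A R"
    by simp_all
  \<comment> \<open>Quartic growth of \<open>F 0\<close> beyond a zero \<open>r\<close>; weakening the factor \<open>A R\<close> to \<open>A R ^ 4\<close> keeps the fourth root linear in \<open>A R\<close>.\<close>
  have after_zero: "\<bar>g s\<bar> \<le> (A R)\<^sup>2 * (s - r)\<^sup>2 \<and> sqrt \<bar>g s\<bar> \<le> A R * (s - r)"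
    if r: "0 < r" "r < s" "s \<le> R" "R < \<rho>" and z: "g r = 0" for r s R
  proof -
    have R: "0 < R" "R < \<rho>" using r by auto
    have "F 0 t = 0" if "0 < t" "t \<le> r" for t
      using that r z root[of r] mono[of t r] F0[of t] by auto
    then have "F 0 s \<le> A R * (s - r) ^ 4"
      using vanishing_then_quartic[of s F "A R" r] der A(3)[OF R] r by auto
    also have "A R * (s - r) ^ 4 \<le> A R ^ 4 * (s - r) ^ 4"
      using self_le_power[OF A(1)[OF R], of 4] r by (intro mult_right_mono) auto
    finally have "F 0 s \<le> A R ^ 4 * (s - r) ^ 4" .
    moreover have sq4: "sqrt \<bar>g s\<bar> ^ 4 = (g s)\<^sup>2"
      using power_mult[of "sqrt \<bar>g s\<bar>" 2 2] by simp
    ultimately have le: "sqrt \<bar>g s\<bar> ^ 4 \<le> (A R * (s - r)) ^ 4"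
      using root[of s] r sq4 by (simp add: power_mult_distrib)
    have pos: "0 < A R * (s - r)" using A(1)[OF R] r by simp
    have e: "sqrt \<bar>g s\<bar> \<le> A R * (s - r)"
      using le pos power_mono_iff[of "sqrt \<bar>g s\<bar>" "A R * (s - r)" 4] by simp
    have "\<bar>g s\<bar> \<le> (A R)\<^sup>2 * (s - r)\<^sup>2"
      using power_mono[OF e, of 2] by (simp add: power_mult_distrib)
    with e show ?thesis by blast
  qed
  show der_g: "DERIV g t :> F 1 t / (2 * g t)" if t: "0 < t" "t < \<rho>" for t
  proof (cases "g t = 0")
    case False
    have "isCont g t" using cont t by (simp add: continuous_on_eq_continuous_at)
    moreover have "\<forall>\<^sub>F s in nhds t. (g s)\<^sup>2 = F 0 s"
      by (rule eventually_mono[OF eventually_nhds_in_open[of "{0<..<\<rho>}" t]]) (use t root in simp_all)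
    ultimately show ?thesis
      using DERIV_root[of "F 0" "F 1 t" t g] der[of 0 t] t False by simp
  next
    case True
    define R where "R = (t + \<rho>) / 2"
    have R: "0 < R" "t < R" "R < \<rho>" using t by (auto simp: R_def)
    have quot: "\<bar>(g s - g t) / (s - t)\<bar> \<le> (A R)\<^sup>2 * \<bar>s - t\<bar>" if s: "0 < s" "s < R" "s \<noteq> t" for s
    proof (cases "s < t")
      case True
      then have "F 0 s = 0"
        using s t R mono[of s t] F0[of s] root[of t] \<open>g t = 0\<close> by auto
      then have "g s = 0" using root[of s] s R by auto
      then show ?thesis using \<open>g t = 0\<close> by simp
    next
      case False
      then have st: "0 < s - t" using s by simp
      then have "\<bar>g s\<bar> \<le> ((A R)\<^sup>2 * \<bar>s - t\<bar>) * (s - t)"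
        using after_zero[of t s R] s t R \<open>g t = 0\<close> by (simp add: power2_eq_square mult.assoc)
      then have "\<bar>g s\<bar> / (s - t) \<le> (A R)\<^sup>2 * \<bar>s - t\<bar>"
        using st by (simp only: pos_divide_le_eq)
      then show ?thesis using st \<open>g t = 0\<close> by simp
    qed
    have "\<forall>\<^sub>F s in at t. s \<in> {0<..<R} - {t}"
      by (rule eventually_at_in_open) (use t R in auto)
    then have "\<forall>\<^sub>F s in at t. norm ((g s - g t) / (s - t)) \<le> (A R)\<^sup>2 * \<bar>s - t\<bar>"
    proof eventually_elim
      case (elim s)
      then have "0 < s" "s < R" "s \<noteq> t" by auto
      from quot[OF this] show ?case unfolding real_norm_def .
    qed
    moreover have "((\<lambda>s. (A R)\<^sup>2 * \<bar>s - t\<bar>) \<longlongrightarrow> 0) (at t)"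
      by (auto intro!: tendsto_eq_intros)
    ultimately have "((\<lambda>s. (g s - g t) / (s - t)) \<longlongrightarrow> 0) (at t)"
      by (rule Lim_null_comparison)
    then show ?thesis using True by (simp add: has_field_derivative_iff)
  qed
  show "\<exists>L. L-lipschitz_on {0<..R} (\<lambda>t. F 1 t / (2 * g t))" (is "\<exists>L. L-lipschitz_on _ ?G")
    if "R < \<rho>" for R
  proof (cases "0 < R")
    case False
    then have "{0<..R} = {}" by auto
    then show ?thesis by (metis lipschitz_on_empty order_refl)
  next
    case True
    \<comment> \<open>The constant is \<open>2880 / 2 + 480\<^sup>2 / 4\<close>, from the two terms of the second derivative.\<close>
    define a L where "a = A R" and "L = 59040 * a\<^sup>2"
    have R: "0 < R" "R < \<rho>" using True that by auto
    have a: "1 \<le> a" using A(1)[OF R] by (simp add: a_def)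
    have bd: "0 < sqrt \<bar>g x\<bar>" "\<bar>g x\<bar> = (sqrt \<bar>g x\<bar>)\<^sup>2"
      "\<bar>F 1 x\<bar> \<le> 480 * a * sqrt \<bar>g x\<bar> ^ 3" "\<bar>F 2 x\<bar> \<le> 2880 * a\<^sup>2 * (sqrt \<bar>g x\<bar>)\<^sup>2"
      if "0 < x" "x \<le> R" "g x \<noteq> 0" for x
    proof -
      have le: "t < \<rho>" "t \<le> R" if "t \<le> x" for t using that \<open>x \<le> R\<close> R by auto
      have "F 0 x \<le> a * x ^ 4" using A(2)[OF R] that by (simp add: a_def)
      note * = quartic_root_bounds[of x a F g, OF that(1) a der[OF _ _ le(1)] _ _ this
          root[OF that(1) le(1)] that(3)]
      have ranges: "0 \<le> F 0 t \<and> F 0 t \<le> F 0 x" "\<bar>F 4 t\<bar> \<le> a" if "0 < t" "t \<le> x" for t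
        using F0[of t] mono[of t x] A(3)[OF R that(1)] that le[of t] le[of x] by (auto simp: a_def)
      show "0 < sqrt \<bar>g x\<bar>" "\<bar>g x\<bar> = (sqrt \<bar>g x\<bar>)\<^sup>2"
        "\<bar>F 1 x\<bar> \<le> 480 * a * sqrt \<bar>g x\<bar> ^ 3" "\<bar>F 2 x\<bar> \<le> 2880 * a\<^sup>2 * (sqrt \<bar>g x\<bar>)\<^sup>2"
        by (rule *(1,2,4,5); use ranges in simp)+
    qed
    have val: "\<bar>?G x\<bar> \<le> 240 * a * sqrt \<bar>g x\<bar>" if x: "0 < x" "x \<le> R" "g x \<noteq> 0" for x
    proof -
      define e where "e = sqrt \<bar>g x\<bar>"
      have e: "0 < e" "\<bar>g x\<bar> = e\<^sup>2" "\<bar>F 1 x\<bar> \<le> 480 * a * e ^ 3" using bd[OF x] by (auto simp: e_def)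
      have "\<bar>?G x\<bar> = \<bar>F 1 x\<bar> / (2 * e\<^sup>2)" by (simp add: abs_mult e)
      also have "\<dots> \<le> (480 * a * e ^ 3) / (2 * e\<^sup>2)" using e by (intro divide_right_mono) auto
      also have "\<dots> = 240 * a * e" using e by (simp add: eval_nat_numeral)
      finally show ?thesis by (simp add: e_def)
    qed
    have slope: "\<bar>F 2 x / (2 * g x) - (F 1 x)\<^sup>2 / (4 * g x ^ 3)\<bar> \<le> L"
      if x: "0 < x" "x \<le> R" "g x \<noteq> 0" for x
    proof -
      define e where "e = sqrt \<bar>g x\<bar>"
      have e: "0 < e" "\<bar>g x\<bar> = e\<^sup>2" "\<bar>F 1 x\<bar> \<le> 480 * a * e ^ 3" "\<bar>F 2 x\<bar> \<le> 2880 * a\<^sup>2 * e\<^sup>2"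
        using bd[OF x] by (auto simp: e_def)
      have "\<bar>F 2 x / (2 * g x)\<bar> \<le> (2880 * a\<^sup>2 * e\<^sup>2) / (2 * e\<^sup>2)"
        unfolding abs_divide abs_mult e(2) abs_numeral using e by (intro divide_right_mono) auto
      moreover have "\<bar>(F 1 x)\<^sup>2 / (4 * g x ^ 3)\<bar> \<le> (480 * a * e ^ 3)\<^sup>2 / (4 * (e\<^sup>2) ^ 3)"
      proof -
        have "\<bar>F 1 x\<bar>\<^sup>2 \<le> (480 * a * e ^ 3)\<^sup>2" using e by (intro power_mono) auto
        then show ?thesis
          unfolding abs_divide abs_mult power_abs e(2) abs_numeral using e
          by (intro divide_right_mono) (auto simp: power_abs)
      qed
      moreover have "(2880 * a\<^sup>2 * e\<^sup>2) / (2 * e\<^sup>2) = 1440 * a\<^sup>2"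
          "(480 * a * e ^ 3)\<^sup>2 / (4 * (e\<^sup>2) ^ 3) = 57600 * a\<^sup>2"
        using e by (simp_all add: power_mult_distrib flip: power_mult)
      ultimately show ?thesis unfolding L_def by linarith
    qed
    have L0: "0 \<le> L" by (simp add: L_def)
    have close: "\<bar>?G s - ?G r\<bar> \<le> L * (s - r)" if rs: "0 < r" "r < s" "s \<le> R" for r s
    proof (cases "g r = 0")
      case True
      show ?thesis
      proof (cases "g s = 0")
        case True
        then show ?thesis using \<open>g r = 0\<close> L0 rs by simp
      next
        case False
        have "\<bar>?G s\<bar> \<le> 240 * a * sqrt \<bar>g s\<bar>" using val rs False by simp
        also have "\<dots> \<le> 240 * a * (a * (s - r))"
          using after_zero[OF rs R(2) True] a by (intro mult_left_mono) (auto simp: a_def)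
        also have "\<dots> = 240 * (a\<^sup>2 * (s - r))" by (simp add: power2_eq_square)
        also have "\<dots> \<le> 59040 * (a\<^sup>2 * (s - r))" using rs by (intro mult_right_mono) auto
        also have "\<dots> = L * (s - r)" by (simp add: L_def)
        finally show ?thesis using \<open>g r = 0\<close> by simp
      qed
    next
      case False
      have nz: "g t \<noteq> 0" if "r \<le> t" "t \<le> s" for t
        using mono[of r t] root[of r] root[of t] that rs R False F0[of r] by (smt (verit) zero_less_power2 zero_eq_power2)
      have G': "DERIV ?G t :> F 2 t / (2 * g t) - (F 1 t)\<^sup>2 / (4 * g t ^ 3)"
        if "r \<le> t" "t \<le> s" for t
        using DERIV_half_quotient[of "F 1" "F 2" t g] der[of 1 t] der_g[of t] nz[OF that] that rs R
        by (simp add: numeral_2_eq_2)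
      obtain z where z: "r < z" "z < s"
        "?G s - ?G r = (s - r) * (F 2 z / (2 * g z) - (F 1 z)\<^sup>2 / (4 * g z ^ 3))"
        using MVT2[OF rs(2) G'] by blast
      show ?thesis
        using slope[of z] nz[of z] z(1,2) rs unfolding z(3)
        by (simp add: abs_mult mult.commute mult_left_mono)
    qed
    have "L-lipschitz_on {0<..R} ?G"
    proof (rule lipschitz_onI)
      fix x y assume "x \<in> {0<..R}" "y \<in> {0<..R}"
      then show "dist (?G x) (?G y) \<le> L * dist x y"
        using close[of x y] close[of y x]
        by (cases x y rule: linorder_cases) (auto simp: dist_real_def abs_minus_commute)
    qed (rule L0)
    then show ?thesis by blast
  qed
qed

text \<open>
  Here \<open>f = a t\<^sup>2 + O(t\<^sup>3)\<close> with \<open>a > 0\<close>. The second derivative of \<open>g\<close> is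
  \<open>(2 f f'' - f'\<^sup>2) / (4 g\<^sup>3)\<close>, and the terms of order \<open>t\<^sup>2\<close> in the numerator cancel, so that numerator and
  denominator are both of order \<open>t\<^sup>3\<close>.
\<close>

lemma root_C11_if_quadratic:
  fixes f g \<kappa> \<kappa>' :: "real \<Rightarrow> real" and \<rho> a :: real
  assumes a: "0 < a"
    and der: "\<And>t. 0 < t \<Longrightarrow> t < \<rho> \<Longrightarrow> DERIV f t :> 2 * t * \<kappa> t"
    and der_\<kappa>: "\<And>t. 0 < t \<Longrightarrow> t < \<rho> \<Longrightarrow> DERIV \<kappa> t :> \<kappa>' t"
    and nonneg: "\<And>t. 0 < t \<Longrightarrow> t < \<rho> \<Longrightarrow> 0 \<le> \<kappa> t"
    and root: "\<And>t. 0 \<le> t \<Longrightarrow> t < \<rho> \<Longrightarrow> (g t)\<^sup>2 = f t" and g0: "g 0 = 0"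
    and cont: "continuous_on {0..<\<rho>} g"
    and bounds: "\<And>R. 0 < R \<Longrightarrow> R < \<rho> \<Longrightarrow>
      \<exists>M. \<forall>t. 0 < t \<and> t \<le> R \<longrightarrow> \<bar>\<kappa> t - a\<bar> \<le> M * t \<and> \<bar>\<kappa>' t\<bar> \<le> M"
  shows "\<And>t. 0 < t \<Longrightarrow> t < \<rho> \<Longrightarrow> DERIV g t :> (2 * t * \<kappa> t) / (2 * g t)"
    and "\<And>R. R < \<rho> \<Longrightarrow> \<exists>L. L-lipschitz_on {0<..R} (\<lambda>t. (2 * t * \<kappa> t) / (2 * g t))"
proof -
  have mono: "f s \<le> f t" if "0 < s" "s \<le> t" "t < \<rho>" for s t
    by (rule DERIV_nonneg_imp_nondecreasing[of s t f])
      (use that in \<open>auto intro!: exI der mult_nonneg_nonneg nonneg\<close>)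
  have f_cont: "continuous_on {0..<\<rho>} f"
    using continuous_on_cong[of "{0..<\<rho>}" "{0..<\<rho>}" f "\<lambda>t. (g t)\<^sup>2"]
      continuous_on_power[OF cont, of 2] root by simp
  have "\<exists>M c. 0 \<le> M \<and> 0 < c \<and> (\<forall>t. 0 < t \<and> t \<le> R \<longrightarrow> \<bar>\<kappa> t - a\<bar> \<le> M * t \<and> \<bar>\<kappa>' t\<bar> \<le> M \<and>
      \<bar>f t - a * t\<^sup>2\<bar> \<le> 2 * M * t ^ 3 \<and> c * t \<le> \<bar>g t\<bar>)" if R: "0 < R" "R < \<rho>" for R
  proof -
    obtain M where M: "\<And>t. 0 < t \<Longrightarrow> t \<le> R \<Longrightarrow> \<bar>\<kappa> t - a\<bar> \<le> M * t \<and> \<bar>\<kappa>' t\<bar> \<le> M"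
      using bounds[OF R] by blast
    have M0: "0 \<le> M" using M[of R] R by auto
    have f_near: "\<bar>f t - a * t\<^sup>2\<bar> \<le> 2 * M * t ^ 3" if t: "0 < t" "t \<le> R" for t
    proof -
      have der': "DERIV (\<lambda>s. f s - a * s\<^sup>2) s :> 2 * s * (\<kappa> s - a)" if "0 < s" "s < t" for s
        using that t R by (auto intro!: derivative_eq_intros der simp: algebra_simps)
      have "\<exists>l z. 0 < z \<and> z < t \<and> DERIV (\<lambda>s. f s - a * s\<^sup>2) z :> l \<and>
          (f t - a * t\<^sup>2) - (f 0 - a * 0\<^sup>2) = (t - 0) * l"
        by (rule MVT) (use t R der' in \<open>auto intro!: continuous_intros
            continuous_on_subset[OF f_cont] simp: real_differentiable_def\<close>)
      then obtain l z where z: "0 < z" "z < t" "DERIV (\<lambda>s. f s - a * s\<^sup>2) z :> l"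
        and eq: "f t - a * t\<^sup>2 = t * l"
        using root[of 0] g0 R by auto
      have l: "l = 2 * z * (\<kappa> z - a)" using der'[OF z(1,2)] z(3) DERIV_unique by blast
      have "\<bar>l\<bar> = 2 * z * \<bar>\<kappa> z - a\<bar>" using z by (simp add: l abs_mult)
      also have "\<dots> \<le> 2 * t * (M * t)"
        using M[of z] z t M0 mult_left_mono[of z t M] by (intro mult_mono) (auto intro: order_trans)
      finally have "t * \<bar>l\<bar> \<le> t * (2 * t * (M * t))" using t by simp
      moreover have "\<bar>f t - a * t\<^sup>2\<bar> = t * \<bar>l\<bar>" using t by (simp add: eq abs_mult)
      ultimately show ?thesis by (simp add: eval_nat_numeral algebra_simps)
    qed
    \<comment> \<open>Chosen such that the cubic error is at most half of \<open>a * t\<^sup>2\<close> for \<open>t \<le> \<delta>\<close>; monotonicity covers larger \<open>t\<close>.\<close>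
    define \<delta> where "\<delta> = min R (a / (4 * M + 1))"
    have \<delta>: "0 < \<delta>" "\<delta> \<le> R" using R a M0 by (auto simp: \<delta>_def)
    have small: "a / 2 * t\<^sup>2 \<le> f t" if t: "0 < t" "t \<le> \<delta>" for t
    proof -
      have "t \<le> a / (4 * M + 1)" using t by (simp add: \<delta>_def)
      then have "t * (4 * M + 1) \<le> a" using M0 by (simp add: pos_le_divide_eq)
      then have "4 * M * t \<le> a" using t by (simp add: algebra_simps)
      then have "(4 * M * t) * t\<^sup>2 \<le> a * t\<^sup>2" by (intro mult_right_mono) auto
      moreover have "(4 * M * t) * t\<^sup>2 = 2 * (2 * M * t ^ 3)" by (simp add: eval_nat_numeral)
      moreover have "a * t\<^sup>2 - f t \<le> 2 * M * t ^ 3" using f_near[of t] t \<delta> by linarith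
      ultimately show ?thesis by linarith
    qed
    define c where "c = a / 2 * (\<delta> / R)\<^sup>2"
    have c: "0 < c" using a \<delta> R by (simp add: c_def)
    have lower: "c * t\<^sup>2 \<le> f t" if t: "0 < t" "t \<le> R" for t
    proof (cases "t \<le> \<delta>")
      case True
      have "(\<delta> / R)\<^sup>2 \<le> 1" using \<delta> R by (intro power_le_one) auto
      then have "c \<le> a / 2" using a mult_left_mono[of "(\<delta> / R)\<^sup>2" 1 "a / 2"] by (simp add: c_def)
      then have "c * t\<^sup>2 \<le> a / 2 * t\<^sup>2" by (intro mult_right_mono) auto
      then show ?thesis using small[of t] True t by linarith
    next
      case False
      have "c * t\<^sup>2 \<le> c * R\<^sup>2" using c t by (intro mult_left_mono power_mono) auto
      also have "\<dots> = a / 2 * \<delta>\<^sup>2" using R by (simp add: c_def power_divide)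
      also have "\<dots> \<le> f \<delta>" using small \<delta> by simp
      also have "\<dots> \<le> f t" using mono[of \<delta> t] False \<delta> t R by simp
      finally show ?thesis .
    qed
    have "sqrt c * t \<le> \<bar>g t\<bar>" if t: "0 < t" "t \<le> R" for t
    proof -
      have "sqrt (c * t\<^sup>2) \<le> sqrt ((g t)\<^sup>2)"
        using lower[OF t] root[of t] t R by (intro real_sqrt_le_mono) auto
      then show ?thesis using t by (simp add: real_sqrt_mult)
    qed
    then show ?thesis
      using M M0 f_near c by (intro exI[of _ M] exI[of _ "sqrt c"]) auto
  qed note est = this
  have gnz: "g t \<noteq> 0" if t: "0 < t" "t < \<rho>" for t
    using est[OF t] t by (metis abs_zero less_eq_real_def mult_pos_pos not_less)
  show der_g: "DERIV g t :> (2 * t * \<kappa> t) / (2 * g t)" if t: "0 < t" "t < \<rho>" for t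
  proof (rule DERIV_root[where f = f])
    show "DERIV f t :> 2 * t * \<kappa> t" "g t \<noteq> 0" using der gnz t by auto
    have "continuous_on {0<..<\<rho>} g" by (rule continuous_on_subset[OF cont]) auto
    then show "isCont g t" using t by (simp add: continuous_on_eq_continuous_at)
    show "\<forall>\<^sub>F s in nhds t. (g s)\<^sup>2 = f s"
      by (rule eventually_mono[OF eventually_nhds_in_open[of "{0<..<\<rho>}" t]]) (use t root in simp_all)
  qed
  show "\<exists>L. L-lipschitz_on {0<..R} (\<lambda>t. (2 * t * \<kappa> t) / (2 * g t))" (is "\<exists>L. L-lipschitz_on _ ?G")
    if "R < \<rho>" for R
  proof (cases "0 < R")
    case False
    then have "{0<..R} = {}" by auto
    then show ?thesis by (metis lipschitz_on_empty order_refl)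
  next
    case True
    have R: "0 < R" "R < \<rho>" using True that by auto
    obtain M c where M: "0 \<le> M" and c: "0 < c"
      and E: "\<And>t. 0 < t \<Longrightarrow> t \<le> R \<Longrightarrow> \<bar>\<kappa> t - a\<bar> \<le> M * t \<and> \<bar>\<kappa>' t\<bar> \<le> M \<and>
        \<bar>f t - a * t\<^sup>2\<bar> \<le> 2 * M * t ^ 3 \<and> c * t \<le> \<bar>g t\<bar>"
      using est[OF R] by blast
    define U where "U = a + 2 * M * R"
    define D where "D t = (2 * \<kappa> t + 2 * t * \<kappa>' t) / (2 * g t) - (2 * t * \<kappa> t)\<^sup>2 / (4 * g t ^ 3)" for t
    have G': "DERIV ?G t :> D t" if t: "0 < t" "t \<le> R" for t
      unfolding D_def
      by (rule DERIV_half_quotient)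
        (use t R der_g[of t] gnz[of t] der_\<kappa>[of t] in \<open>auto intro!: derivative_eq_intros\<close>)
    have "\<bar>D t\<bar> \<le> 4 * U * M / c ^ 3" if t: "0 < t" "t \<le> R" for t
    proof -
      note e = E[OF t]
      \<comment> \<open>The numerator \<open>2 f f'' - f'\<^sup>2\<close>, written so that the cancellation is visible.\<close>
      define N where "N = 4 * \<kappa> t * (f t - t\<^sup>2 * \<kappa> t) + 4 * t * f t * \<kappa>' t"
      have D: "D t = N / (4 * g t ^ 3)"
        using gnz[of t] t R root[of t]
        by (simp add: D_def N_def field_simps eval_nat_numeral flip: root)
      have MtR: "M * t \<le> M * R" "0 \<le> M * R" using M t by (auto intro: mult_left_mono)
      have \<kappa>U: "0 \<le> \<kappa> t" "\<kappa> t \<le> U" using e MtR nonneg[of t] t R by (auto simp: U_def)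
      have fU: "0 \<le> f t" "f t \<le> U * t\<^sup>2"
      proof -
        show "0 \<le> f t" using root[of t] t R by (metis less_eq_real_def order_le_less_trans zero_le_power2)
        have "f t \<le> a * t\<^sup>2 + 2 * (M * t) * t\<^sup>2" using e by (simp add: eval_nat_numeral algebra_simps abs_le_iff)
        also have "\<dots> \<le> a * t\<^sup>2 + 2 * (M * R) * t\<^sup>2"
          using MtR by (intro add_left_mono mult_right_mono) auto
        finally show "f t \<le> U * t\<^sup>2" by (simp add: U_def algebra_simps)
      qed
      have "\<bar>f t - t\<^sup>2 * \<kappa> t\<bar> \<le> 3 * M * t ^ 3"
      proof -
        have "\<bar>t\<^sup>2 * (\<kappa> t - a)\<bar> \<le> t\<^sup>2 * (M * t)"
          using e by (simp add: abs_mult mult_left_mono)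
        then show ?thesis using e by (simp add: abs_le_iff eval_nat_numeral algebra_simps)
      qed
      then have "\<bar>4 * \<kappa> t * (f t - t\<^sup>2 * \<kappa> t)\<bar> \<le> 4 * U * (3 * M * t ^ 3)"
        unfolding abs_mult using \<kappa>U M t by (intro mult_mono) auto
      moreover have "\<bar>4 * t * f t * \<kappa>' t\<bar> \<le> 4 * t * (U * t\<^sup>2) * M"
        unfolding abs_mult using fU e t by (intro mult_mono) (auto intro: mult_nonneg_nonneg)
      ultimately have "\<bar>N\<bar> \<le> 16 * U * M * t ^ 3"
        unfolding N_def by (simp add: eval_nat_numeral algebra_simps)
      moreover have "4 * (c * t) ^ 3 \<le> \<bar>4 * g t ^ 3\<bar>"
        using e c t by (simp add: abs_mult power_abs power_mono)
      moreover have "0 \<le> 16 * U * M * t ^ 3" using a M R t by (simp add: U_def)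
      ultimately have "\<bar>D t\<bar> \<le> (16 * U * M * t ^ 3) / (4 * (c * t) ^ 3)"
        unfolding D abs_divide using c t by (intro frac_le) auto
      also have "\<dots> = 4 * U * M / c ^ 3" using t c by (simp add: power_mult_distrib)
      finally show ?thesis .
    qed
    then have D_bound: "norm (D t) \<le> 4 * U * M / c ^ 3" if "t \<in> {0<..R}" for t
      using that by simp
    have "norm (?G x - ?G y) \<le> 4 * U * M / c ^ 3 * norm (x - y)" if "x \<in> {0<..R}" "y \<in> {0<..R}" for x y
    proof (rule field_differentiable_bound[OF _ _ D_bound that])
      show "(?G has_field_derivative D t) (at t within {0<..R})" if "t \<in> {0<..R}" for t
        by (rule has_field_derivative_at_within[OF G']) (use that in auto)
    qed auto
    then have "(4 * U * M / c ^ 3)-lipschitz_on {0<..R} ?G"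
      using a M c R by (intro lipschitz_onI) (auto simp: dist_norm U_def)
    then show ?thesis by blast
  qed
qed

lemma bounded_on_Icc:
  fixes F :: "real \<Rightarrow> real"
  assumes "continuous_on {-\<rho><..<\<rho>} F" "R < \<rho>"
  shows "\<exists>M. \<forall>t\<in>{0..R}. \<bar>F t\<bar> \<le> M"
proof -
  have "continuous_on {0..R} F" by (rule continuous_on_subset[OF assms(1)]) (use assms(2) in auto)
  then have "bounded (F ` {0..R})"
    by (intro compact_imp_bounded compact_continuous_image) auto
  then show ?thesis by (auto simp: bounded_iff)
qed

text \<open>
  The two preceding cases are exhaustive for a profile satisfying the radial equation: if \<open>K 0\<close> vanishes
  at \<open>0\<close>, it has a minimum there, hence is \<open>O(t\<^sup>2)\<close>, and integration makes \<open>g\<^sup>2\<close> a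
  quantity of order \<open>t\<^sup>4\<close>. Here \<open>K m\<close> stands for the \<open>m\<close>-th derivative of the restriction of \<open>k\<close> to a line.
\<close>

lemma root_of_radial_integral_C11:
  fixes K :: "nat \<Rightarrow> real \<Rightarrow> real" and g :: "real \<Rightarrow> real" and \<rho> :: real
  assumes pos: "0 < \<rho>"
    and K: "\<And>m t. m < 3 \<Longrightarrow> \<bar>t\<bar> < \<rho> \<Longrightarrow> DERIV (K m) t :> K (Suc m) t"
    and K3: "continuous_on {-\<rho><..<\<rho>} (K 3)"
    and nonneg: "\<And>t. \<bar>t\<bar> < \<rho> \<Longrightarrow> 0 \<le> K 0 t"
    and g0: "g 0 = 0" and g_cont: "continuous_on {0..<\<rho>} g"
    and der: "\<And>t. 0 < t \<Longrightarrow> t < \<rho> \<Longrightarrow> DERIV (\<lambda>r. (g r)\<^sup>2) t :> 2 * t * K 0 t"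
  obtains G where "\<And>t. 0 < t \<Longrightarrow> t < \<rho> \<Longrightarrow> DERIV g t :> G t"
    and "\<And>R. R < \<rho> \<Longrightarrow> \<exists>L. L-lipschitz_on {0<..R} G"
proof -
  have K_cont: "continuous_on {-\<rho><..<\<rho>} (K m)" if "m \<le> 3" for m
  proof (cases "m = 3")
    case True
    then show ?thesis using K3 by simp
  next
    case False
    then show ?thesis
      using that K[of m] by (intro DERIV_continuous_on[of _ _ "K (Suc m)"]) (auto intro: has_field_derivative_at_within)
  qed
  have K_bound: "\<exists>M. \<forall>t\<in>{0..R}. \<bar>K m t\<bar> \<le> M" if "m \<le> 3" "R < \<rho>" for m R
    using bounded_on_Icc[OF K_cont that(2)] that(1) by blast
  define G where "G t = (2 * t * K 0 t) / (2 * g t)" for t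
  have "0 \<le> K 0 0" using nonneg pos by simp
  then consider "0 < K 0 0" | "K 0 0 = 0" by linarith
  then have "(\<forall>t. 0 < t \<longrightarrow> t < \<rho> \<longrightarrow> DERIV g t :> G t) \<and> (\<forall>R<\<rho>. \<exists>L. L-lipschitz_on {0<..R} G)"
  proof cases
    case 1
    have bounds: "\<exists>M. \<forall>t. 0 < t \<and> t \<le> R \<longrightarrow> \<bar>K 0 t - K 0 0\<bar> \<le> M * t \<and> \<bar>K 1 t\<bar> \<le> M"
      if R: "0 < R" "R < \<rho>" for R
    proof -
      obtain M where M: "\<forall>t\<in>{0..R}. \<bar>K 1 t\<bar> \<le> M" using K_bound[of 1 R] R by auto
      have "norm (K 0 t - K 0 0) \<le> M * norm (t - 0)" if "0 < t" "t \<le> R" for t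
      proof (rule field_differentiable_bound)
        show "(K 0 has_field_derivative K 1 s) (at s within {0..R})" if "s \<in> {0..R}" for s
          using K[of 0 s] that R by (auto intro: has_field_derivative_at_within)
      qed (use M that in auto)
      then show ?thesis using M by (intro exI[of _ M]) auto
    qed
    note C11 = root_C11_if_quadratic[where \<kappa> = "K 0" and \<kappa>' = "K 1" and f = "\<lambda>r. (g r)\<^sup>2" and g = g and \<rho> = \<rho>, OF 1]
    have "DERIV g t :> G t" if "0 < t" "t < \<rho>" for t
      unfolding G_def by (rule C11(1)) (use that der K[of 0] nonneg g0 g_cont bounds in auto)
    moreover have "\<exists>L. L-lipschitz_on {0<..R} G" if "R < \<rho>" for R
      unfolding G_def by (rule C11(2)) (use that der K[of 0] nonneg g0 g_cont bounds in auto)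
    ultimately show ?thesis by blast
  next
    case 2
    \<comment> \<open>The function \<open>g\<^sup>2\<close> and its four derivatives, computed from the equation.\<close>
    define F where "F m = [\<lambda>r. (g r)\<^sup>2, \<lambda>t. 2 * t * K 0 t, \<lambda>t. 2 * K 0 t + 2 * t * K 1 t,
      \<lambda>t. 4 * K 1 t + 2 * t * K 2 t, \<lambda>t. 6 * K 2 t + 2 * t * K 3 t] ! m" for m
    have F: "F 0 = (\<lambda>r. (g r)\<^sup>2)" "F 1 = (\<lambda>t. 2 * t * K 0 t)" "F 2 = (\<lambda>t. 2 * K 0 t + 2 * t * K 1 t)"
      "F 3 = (\<lambda>t. 4 * K 1 t + 2 * t * K 2 t)" "F 4 = (\<lambda>t. 6 * K 2 t + 2 * t * K 3 t)"
      by (simp_all add: F_def)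
    have F_der: "DERIV (F m) t :> F (Suc m) t" if m: "m < 4" and t: "0 < t" "t < \<rho>" for m t
    proof -
      have K': "DERIV (K 0) t :> K 1 t" "DERIV (K 1) t :> K 2 t" "DERIV (K 2) t :> K 3 t"
        using K[of 0 t] K[of 1 t] K[of 2 t] t by (simp_all add: eval_nat_numeral)
      consider "m = 0" | "m = 1" | "m = 2" | "m = 3" using m by linarith
      then show ?thesis
      proof cases
        case 1
        then show ?thesis using der[OF t] F(1,2) by simp
      next
        case 2
        have "DERIV (F 1) t :> F 2 t" unfolding F
          by (rule derivative_eq_intros K' refl)+ simp
        then show ?thesis using 2 by (simp add: numeral_2_eq_2)
      next
        case 3
        have "DERIV (F 2) t :> F 3 t" unfolding F
          by (rule derivative_eq_intros K' refl)+ simp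
        then show ?thesis using 3 by (simp add: eval_nat_numeral)
      next
        case 4
        have "DERIV (F 3) t :> F 4 t" unfolding F
          by (rule derivative_eq_intros K' refl)+ simp
        then show ?thesis using 4 by (simp add: eval_nat_numeral)
      qed
    qed
    have K1: "K 1 0 = 0"
    proof (rule DERIV_local_min)
      show "DERIV (K 0) 0 :> K 1 0" using K[of 0 0] pos by simp
      show "\<forall>y. \<bar>0 - y\<bar> < \<rho> \<longrightarrow> K 0 0 \<le> K 0 y" using nonneg 2 by auto
    qed (rule pos)
    have bounds: "\<exists>M. \<forall>t. 0 < t \<and> t \<le> R \<longrightarrow> F 0 t \<le> M * t ^ 4 \<and> \<bar>F 4 t\<bar> \<le> M"
      if R: "0 < R" "R < \<rho>" for R
    proof -
      obtain M2 M3 where "\<forall>t\<in>{0..R}. \<bar>K 2 t\<bar> \<le> M2" "\<forall>t\<in>{0..R}. \<bar>K 3 t\<bar> \<le> M3"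
        using K_bound[of 2 R] K_bound[of 3 R] R by auto
      then have M: "\<bar>K 2 t\<bar> \<le> M2" "\<bar>K 3 t\<bar> \<le> M3" if "t \<in> {0..R}" for t
        using that by blast+
      have M0: "0 \<le> M2" "0 \<le> M3" using M(1)[of 0] M(2)[of 0] R by auto
      have K0: "K 0 t \<le> M2 * t\<^sup>2" if t: "0 < t" "t \<le> R" for t
      proof -
        have "\<exists>s. 0 < s \<and> s < t \<and> K 0 t = (\<Sum>m<2. K m 0 / fact m * (t - 0) ^ m) + K 2 s / fact 2 * (t - 0) ^ 2"
          by (rule Taylor_up[where a = 0 and b = t]) (use t R K in auto)
        then obtain s where s: "0 < s" "s < t" "K 0 t = K 2 s / 2 * t\<^sup>2"
          using 2 K1 by (auto simp: eval_nat_numeral)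
        have "K 2 s / 2 * t\<^sup>2 \<le> M2 * t\<^sup>2"
          using M(1)[of s] s t M0 by (intro mult_right_mono) auto
        then show ?thesis by (simp only: s(3))
      qed
      have F0: "F 0 t \<le> 2 * M2 * t ^ 4" if t: "0 < t" "t \<le> R" for t
      proof -
        have "\<exists>l s. 0 < s \<and> s < t \<and> DERIV (\<lambda>r. (g r)\<^sup>2) s :> l \<and> (g t)\<^sup>2 - (g 0)\<^sup>2 = (t - 0) * l"
        proof (rule MVT)
          show "(\<lambda>r. (g r)\<^sup>2) differentiable (at s)" if "0 < s" "s < t" for s
            using der[of s] that t R real_differentiable_def by auto
          show "continuous_on {0..t} (\<lambda>r. (g r)\<^sup>2)"
            by (intro continuous_on_power continuous_on_subset[OF g_cont]) (use t R in auto)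
        qed (rule t)
        then obtain l s where s: "0 < s" "s < t" "DERIV (\<lambda>r. (g r)\<^sup>2) s :> l" "(g t)\<^sup>2 = t * l"
          using g0 by auto
        have "l = 2 * s * K 0 s" using DERIV_unique[OF s(3) der] s t R by simp
        also have "\<dots> \<le> 2 * t * (M2 * t\<^sup>2)"
        proof (rule mult_mono)
          have "M2 * s\<^sup>2 \<le> M2 * t\<^sup>2" using s M0 by (intro mult_left_mono power_mono) auto
          then show "K 0 s \<le> M2 * t\<^sup>2" using K0[of s] s t by simp
          show "0 \<le> K 0 s" using nonneg s t R by simp
        qed (use s in auto)
        finally have "t * l \<le> t * (2 * t * (M2 * t\<^sup>2))" using t by simp
        also have "\<dots> = 2 * M2 * t ^ 4" by (simp add: eval_nat_numeral)
        finally show ?thesis by (simp add: F(1) s(4))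
      qed
      have F4: "\<bar>F 4 t\<bar> \<le> 6 * M2 + 2 * R * M3" if t: "0 < t" "t \<le> R" for t
      proof -
        have "\<bar>2 * t * K 3 t\<bar> \<le> 2 * R * M3"
          unfolding abs_mult using M(2)[of t] t by (intro mult_mono) auto
        then show ?thesis using M(1)[of t] t unfolding F by auto
      qed
      have "F 0 t \<le> (6 * M2 + 2 * R * M3) * t ^ 4" if t: "0 < t" "t \<le> R" for t
      proof (rule order_trans[OF F0[OF t]])
        have "0 \<le> 2 * R * M3" using R M0 by simp
        then show "2 * M2 * t ^ 4 \<le> (6 * M2 + 2 * R * M3) * t ^ 4"
          using M0 by (intro mult_right_mono) auto
      qed
      then show ?thesis using F4 by blast
    qed
    have incr: "0 \<le> F 1 t" if "0 < t" "t < \<rho>" for t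
      using nonneg[of t] that unfolding F by simp
    have cont: "continuous_on {0<..<\<rho>} g" by (rule continuous_on_subset[OF g_cont]) auto
    note C11 = root_C11_if_quartic[of \<rho> F g, OF F_der incr _ cont bounds, unfolded F(2)]
    show ?thesis
      unfolding G_def by (intro conjI allI impI C11) (simp_all add: F(1))
  qed
  then show thesis using that by blast
qed

section \<open>Regularity of radial functions\<close>

text \<open>
  The limit does not depend on the interval on which the Lipschitz bound is taken, although the constant
  does.
\<close>

lemma lipschitz_right_limit:
  fixes G :: "real \<Rightarrow> real"
  assumes \<rho>: "0 < \<rho>" and lip: "\<And>R. R < \<rho> \<Longrightarrow> \<exists>L. L-lipschitz_on {0<..R} G"
  obtains l where "\<And>L R r. R < \<rho> \<Longrightarrow> L-lipschitz_on {0<..R} G \<Longrightarrow> 0 < r \<Longrightarrow> r \<le> R \<Longrightarrow> \<bar>G r - l\<bar> \<le> L * r"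
proof -
  let ?S = "{0<..\<rho>/2}"
  obtain L0 where "L0-lipschitz_on ?S G" using lip[of "\<rho>/2"] \<rho> by auto
  then have uc: "uniformly_continuous_on ?S G" by (rule lipschitz_on_uniformly_continuous)
  have cl: "0 \<in> closure ?S" using closure_greaterThanAtMost[of 0 "\<rho>/2"] \<rho> by auto
  obtain l where l: "(G \<longlongrightarrow> l) (at 0 within ?S)"
    by (rule uniformly_continuous_on_extension_at_closure[OF uc cl])
  have nt: "at 0 within ?S \<noteq> bot"
    using cl not_trivial_limit_within[of 0 ?S] by simp
  show thesis
  proof (rule that[of l])
    fix L R r assume R: "R < \<rho>" and L: "L-lipschitz_on {0<..R} G" and r: "0 < r" "r \<le> R"
    have "((\<lambda>s. \<bar>G r - G s\<bar>) \<longlongrightarrow> \<bar>G r - l\<bar>) (at 0 within ?S)"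
      by (intro tendsto_intros l)
    moreover have "\<forall>\<^sub>F s in at 0 within ?S. \<bar>G r - G s\<bar> \<le> L * r"
      unfolding eventually_at
    proof (intro exI[of _ r] conjI ballI impI)
      fix s assume "s \<in> ?S" "s \<noteq> 0 \<and> dist s 0 < r"
      then have s: "0 < s" "s < r" by auto
      have "dist (G r) (G s) \<le> L * dist r s" using lipschitz_onD[OF L] r s by auto
      also have "\<dots> \<le> L * r"
        using s lipschitz_on_nonneg[OF L] by (intro mult_left_mono) (auto simp: dist_real_def)
      finally show "\<bar>G r - G s\<bar> \<le> L * r" by (simp add: dist_real_def)
    qed (rule r(1))
    ultimately show "\<bar>G r - l\<bar> \<le> L * r" using nt by (rule tendsto_upperbound)
  qed
qed

text \<open>
  A function of the direction alone, such as \<open>x $ i * x $ j / (norm x)\<^sup>2\<close>, is not Lipschitz at the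
  origin; its variation is of order \<open>norm (x - y) / norm y\<close>. A radial factor which is Lipschitz and vanishes
  linearly at the origin compensates for this.
\<close>

lemma lipschitz_direction_product:
  fixes x y :: "real^'n" and w :: "real \<Rightarrow> real"
  assumes nz: "x \<noteq> 0" "y \<noteq> 0"
    and w: "\<bar>w (norm x) - w (norm y)\<bar> \<le> M * \<bar>norm x - norm y\<bar>" "\<bar>w (norm y)\<bar> \<le> M * norm y"
    and M: "0 \<le> M"
  shows "\<bar>w (norm x) * (x $ i / norm x) * (x $ j / norm x) - w (norm y) * (y $ i / norm y) * (y $ j / norm y)\<bar>
    \<le> 5 * M * norm (x - y)"
proof -
  define r s where "r = norm x" and "s = norm y"
  define a b where "a k = x $ k / r" and "b k = y $ k / s" for k
  have rs: "0 < r" "0 < s" using nz by (auto simp: r_def s_def)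
  have d: "\<bar>r - s\<bar> \<le> norm (x - y)" by (simp add: r_def s_def norm_triangle_ineq3)
  have a1: "\<bar>a k\<bar> \<le> 1" "\<bar>b k\<bar> \<le> 1" for k
    using component_le_norm_cart[of x k] component_le_norm_cart[of y k] rs
    by (auto simp: a_def b_def r_def s_def)
  \<comment> \<open>Moving from \<open>y\<close> to \<open>x\<close> changes the direction by at most \<open>2 * norm (x - y) / s\<close>.\<close>
  have turn: "s * \<bar>a k - b k\<bar> \<le> 2 * norm (x - y)" for k
  proof -
    have "s * (a k - b k) = (s - r) * a k + (x - y) $ k"
      using rs by (simp add: a_def b_def field_simps)
    moreover have "\<bar>(s - r) * a k\<bar> \<le> norm (x - y)"
      using d a1[of k] mult_mono[of "\<bar>s - r\<bar>" "norm (x - y)" "\<bar>a k\<bar>" 1] by (simp add: abs_mult)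
    moreover have "\<bar>(x - y) $ k\<bar> \<le> norm (x - y)" by (rule component_le_norm_cart)
    moreover have "\<bar>s * (a k - b k)\<bar> = s * \<bar>a k - b k\<bar>" using rs by (simp add: abs_mult)
    ultimately show ?thesis by linarith
  qed
  have split: "w r * a i * a j - w s * b i * b j
      = (w r - w s) * (a i * a j) + w s * ((a i - b i) * a j + b i * (a j - b j))"
    by (simp add: algebra_simps)
  have radial: "\<bar>(w r - w s) * (a i * a j)\<bar> \<le> M * norm (x - y)"
  proof -
    have "\<bar>w r - w s\<bar> \<le> M * norm (x - y)"
      using w(1) mult_left_mono[OF d M] by (simp add: r_def s_def)
    moreover have "\<bar>a i * a j\<bar> \<le> 1" using a1 mult_mono[of "\<bar>a i\<bar>" 1 "\<bar>a j\<bar>" 1] by (simp add: abs_mult)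
    ultimately show ?thesis
      using mult_mono[of "\<bar>w r - w s\<bar>" "M * norm (x - y)" "\<bar>a i * a j\<bar>" 1] M by (simp add: abs_mult)
  qed
  have angular: "\<bar>w s * ((a i - b i) * a j + b i * (a j - b j))\<bar> \<le> 4 * M * norm (x - y)"
  proof -
    have "\<bar>(a i - b i) * a j\<bar> \<le> \<bar>a i - b i\<bar>" "\<bar>b i * (a j - b j)\<bar> \<le> \<bar>a j - b j\<bar>"
      using a1 by (simp_all add: abs_mult mult_left_le mult_left_le_one_le)
    then have "\<bar>(a i - b i) * a j + b i * (a j - b j)\<bar> \<le> \<bar>a i - b i\<bar> + \<bar>a j - b j\<bar>" by linarith
    then have "\<bar>w s * ((a i - b i) * a j + b i * (a j - b j))\<bar> \<le> (M * s) * (\<bar>a i - b i\<bar> + \<bar>a j - b j\<bar>)"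
      unfolding abs_mult using w(2) M rs by (intro mult_mono) (auto simp: s_def)
    also have "\<dots> = M * (s * \<bar>a i - b i\<bar> + s * \<bar>a j - b j\<bar>)" by (simp add: algebra_simps)
    also have "\<dots> \<le> M * (2 * norm (x - y) + 2 * norm (x - y))"
      using turn M by (intro mult_left_mono add_mono)
    finally show ?thesis by simp
  qed
  have "\<bar>w r * a i * a j - w s * b i * b j\<bar> \<le> M * norm (x - y) + 4 * M * norm (x - y)"
    unfolding split by (rule order_trans[OF abs_triangle_ineq add_mono[OF radial angular]])
  then show ?thesis by (simp add: a_def b_def r_def s_def)
qed

lemma compact_subset_ball_subset_cball:
  fixes K :: "('a::real_normed_vector) set"
  assumes "compact K" "K \<subseteq> ball 0 \<rho>"
  obtains R where "R < \<rho>" "K \<subseteq> cball 0 R"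
proof (cases "K = {}")
  case True
  then show thesis using that[of "\<rho> - 1"] by simp
next
  case False
  then obtain x where x: "x \<in> K" "\<And>y. y \<in> K \<Longrightarrow> norm y \<le> norm x"
    using continuous_attains_sup[OF assms(1), of norm] by (auto intro: continuous_intros)
  show thesis by (rule that[of "norm x"]) (use x assms in auto)
qed

lemma DERIV_divide_id:
  fixes g :: "real \<Rightarrow> real"
  assumes g: "DERIV g t :> D" and t: "t \<noteq> 0"
  shows "DERIV (\<lambda>r. g r / r) t :> (D - g t / t) / t"
  by (rule derivative_eq_intros g refl t)+ (use t in \<open>simp add: divide_simps\<close>)

lemma radial_field_has_derivative:
  fixes g G :: "real \<Rightarrow> real" and x :: "real^'n"
  assumes x: "x \<noteq> 0" and g: "DERIV g (norm x) :> G (norm x)"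
  shows "((\<lambda>y. g (norm y) / norm y * y $ i) has_derivative
    (\<lambda>v. g (norm x) / norm x * v $ i +
      (G (norm x) - g (norm x) / norm x) * (x \<bullet> v / norm x) * (x $ i / norm x))) (at x)"
proof -
  have n: "(norm has_derivative (\<lambda>v. x \<bullet> v / norm x)) (at x)"
    using has_derivative_norm[OF x] by (simp add: sgn_div_norm inner_commute divide_inverse_commute)
  have q: "DERIV (\<lambda>r. g r / r) (norm x) :> (G (norm x) - g (norm x) / norm x) / norm x"
    by (rule DERIV_divide_id[OF g]) (use x in simp)
  have "((\<lambda>y. g (norm y) / norm y) has_derivative
      (\<lambda>v. (G (norm x) - g (norm x) / norm x) / norm x * (x \<bullet> v / norm x))) (at x)"
    using has_derivative_compose[OF n] q unfolding has_field_derivative_def by blast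
  moreover have "((\<lambda>y. y $ i) has_derivative (\<lambda>v. v $ i)) (at x)"
    by (rule bounded_linear_imp_has_derivative) (rule bounded_linear_vec_nth)
  ultimately show ?thesis
    by (rule has_derivative_eq_rhs[OF has_derivative_mult]) (use x in \<open>simp add: fun_eq_iff field_simps\<close>)
qed

lemma partial_deriv_eqI:
  "(f has_derivative f') (at x) \<Longrightarrow> partial_deriv i f x = f' (axis i 1)"
  by (simp add: partial_deriv_def frechet_derivative_at[symmetric])

text \<open>
  With \<open>q r = g r / r\<close> and \<open>w = G - q\<close>, the second derivatives of \<open>u\<close> are
  \<open>q (norm x)\<close> times the identity plus \<open>w (norm x)\<close> times the products of direction cosines. By the mean value
  theorem \<open>q r\<close> is a value of \<open>G\<close> on \<open>(0, r)\<close>; since \<open>G\<close> is Lipschitz this gives \<open>w r = O(r)\<close>, and then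
  \<open>q' = w / r\<close> is bounded. So \<open>q\<close> is Lipschitz and \<open>lipschitz_direction_product\<close> applies to \<open>w\<close>.
  At the origin the Hessian is \<open>l\<close> times the identity, where \<open>l\<close> is the limit of \<open>G\<close>.
\<close>

lemma radial_profile_Ck1:
  fixes u :: "real^'n \<Rightarrow> real" and g G :: "real \<Rightarrow> real"
  assumes pos: "0 < \<rho>"
    and u_diff: "\<And>x. x \<in> ball 0 \<rho> \<Longrightarrow> u differentiable (at x)"
    and grad_u: "\<And>i x. x \<in> ball 0 \<rho> \<Longrightarrow> partial_deriv i u x = g (norm x) / norm x * x $ i"
    and g0: "g 0 = 0" and g_cont: "continuous_on {0..<\<rho>} g"
    and g_der: "\<And>t. 0 < t \<Longrightarrow> t < \<rho> \<Longrightarrow> DERIV g t :> G t"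
    and lip: "\<And>R. R < \<rho> \<Longrightarrow> \<exists>L. L-lipschitz_on {0<..R} G"
  shows "Ck1_on 2 (ball 0 \<rho>) u"
proof -
  obtain l where l: "\<And>L R r. R < \<rho> \<Longrightarrow> L-lipschitz_on {0<..R} G \<Longrightarrow> 0 < r \<Longrightarrow> r \<le> R \<Longrightarrow> \<bar>G r - l\<bar> \<le> L * r"
    using lipschitz_right_limit[OF pos lip] by blast
  define q w where "q r = g r / r" and "w r = G r - g r / r" for r
  define W where "W i j x = w (norm x) * (x $ i / norm x) * (x $ j / norm x)"
    for i j and x :: "real^'n"
  define H where "H i j x = (if x = 0 then (if i = j then l else 0)
      else q (norm x) * (if i = j then 1 else 0) + W i j x)"
    for i j and x :: "real^'n"
  have mean: "\<exists>z. 0 < z \<and> z < r \<and> q r = G z" if r: "0 < r" "r < \<rho>" for r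
  proof -
    have "\<exists>d z. 0 < z \<and> z < r \<and> DERIV g z :> d \<and> g r - g 0 = (r - 0) * d"
    proof (rule MVT)
      show "g differentiable (at t)" if "0 < t" "t < r" for t
        using g_der[of t] that r real_differentiable_def by auto
    qed (use r in \<open>auto intro: continuous_on_subset[OF g_cont]\<close>)
    then obtain d z where z: "0 < z" "z < r" "DERIV g z :> d" "g r = r * d" using g0 by auto
    then have "d = G z" using g_der[of z] r DERIV_unique by fastforce
    then show ?thesis using z r by (intro exI[of _ z]) (simp add: q_def)
  qed
  have q_near: "\<bar>q r - l\<bar> \<le> L * r" and w_near: "\<bar>w r\<bar> \<le> L * r"
    if L: "R < \<rho>" "L-lipschitz_on {0<..R} G" and r: "0 < r" "r \<le> R" for L R r
  proof -
    obtain z where z: "0 < z" "z < r" "q r = G z" using mean[of r] r L by auto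
    have L0: "0 \<le> L" by (rule lipschitz_on_nonneg[OF L(2)])
    have "\<bar>G z - l\<bar> \<le> L * z" using l[OF L, of z] z r by simp
    also have "\<dots> \<le> L * r" using L0 z by (intro mult_left_mono) auto
    finally show "\<bar>q r - l\<bar> \<le> L * r" using z by simp
    have "dist (G r) (G z) \<le> L * dist r z" using lipschitz_onD[OF L(2)] r z by auto
    also have "\<dots> \<le> L * r" using L0 z by (intro mult_left_mono) (auto simp: dist_real_def)
    finally show "\<bar>w r\<bar> \<le> L * r" using z(3) by (simp add: w_def q_def dist_real_def)
  qed
  have q_lip: "\<bar>q r - q s\<bar> \<le> L * \<bar>r - s\<bar>" and w_lip: "\<bar>w r - w s\<bar> \<le> 2 * L * \<bar>r - s\<bar>"
    if L: "R < \<rho>" "L-lipschitz_on {0<..R} G" and r: "0 < r" "r \<le> R" and s: "0 < s" "s \<le> R"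
    for L R r s
  proof -
    have "norm (q r - q s) \<le> L * norm (r - s)"
    proof (rule field_differentiable_bound)
      show "(q has_field_derivative w t / t) (at t within {0<..R})" if "t \<in> {0<..R}" for t
        unfolding q_def w_def
        by (rule has_field_derivative_at_within[OF DERIV_divide_id[OF g_der]]) (use that L in auto)
      show "norm (w t / t) \<le> L" if "t \<in> {0<..R}" for t
        using w_near[OF L, of t] that by (simp add: pos_divide_le_eq)
    qed (use r s in auto)
    then show *: "\<bar>q r - q s\<bar> \<le> L * \<bar>r - s\<bar>" by simp
    have "dist (G r) (G s) \<le> L * dist r s" using lipschitz_onD[OF L(2)] r s by auto
    then show "\<bar>w r - w s\<bar> \<le> 2 * L * \<bar>r - s\<bar>"
      using * unfolding w_def q_def dist_real_def by linarith
  qed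
  have second: "(partial_deriv i u has_derivative (\<lambda>v. if x = 0 then l * v $ i else
      q (norm x) * v $ i + w (norm x) * (x \<bullet> v / norm x) * (x $ i / norm x))) (at x)"
    if x: "x \<in> ball 0 \<rho>" for i x
  proof (rule has_derivative_transform_within_open[OF _ open_ball x])
    show "g (norm y) / norm y * y $ i = partial_deriv i u y" if "y \<in> ball 0 \<rho>" for y
      using grad_u that by simp
    show "((\<lambda>y. g (norm y) / norm y * y $ i) has_derivative (\<lambda>v. if x = 0 then l * v $ i else
      q (norm x) * v $ i + w (norm x) * (x \<bullet> v / norm x) * (x $ i / norm x))) (at x)"
    proof (cases "x = 0")
      case False
      then show ?thesis
        using radial_field_has_derivative[OF False, of g G i] g_der[of "norm x"] x
        by (simp add: q_def w_def)
    next
      case x0: True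
      define R where "R = \<rho> / 2"
      have R: "0 < R" "R < \<rho>" using pos by (auto simp: R_def)
      obtain L where L: "L-lipschitz_on {0<..R} G" using lip[OF R(2)] by blast
      have "((\<lambda>y. g (norm y) / norm y * y $ i) has_derivative (\<lambda>v. l * v $ i)) (at 0)"
        unfolding has_derivative_at
      proof
        show "bounded_linear (\<lambda>v. l * v $ i)"
          by (intro bounded_linear_const_mult bounded_linear_vec_nth)
        have est: "norm (norm (g (norm (0 + h)) / norm (0 + h) * (0 + h) $ i
            - g (norm (0::real^'n)) / norm (0::real^'n) * 0 $ i - l * h $ i) / norm h) \<le> L * norm h"
          if h: "h \<in> ball 0 R - {0}" for h :: "real^'n"
        proof -
          have "\<bar>(q (norm h) - l) * h $ i\<bar> \<le> L * norm h * norm h"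
            unfolding abs_mult
            by (intro mult_mono q_near[OF R(2) L] component_le_norm_cart)
              (use h lipschitz_on_nonneg[OF L] in auto)
          then have "\<bar>(q (norm h) - l) * h $ i\<bar> / norm h \<le> L * norm h"
            using h by (simp add: pos_divide_le_eq)
          then show ?thesis by (simp add: q_def algebra_simps)
        qed
        have "\<forall>\<^sub>F h in at 0. h \<in> ball 0 R - {0 :: real^'n}"
          by (rule eventually_at_in_open) (use R in auto)
        then have "\<forall>\<^sub>F h in at 0. norm (norm (g (norm (0 + h)) / norm (0 + h) * (0 + h) $ i
            - g (norm (0::real^'n)) / norm (0::real^'n) * 0 $ i - l * h $ i) / norm h) \<le> L * norm h"
          by (rule eventually_mono) (rule est)
        moreover have "((\<lambda>h :: real^'n. L * norm h) \<longlongrightarrow> 0) (at 0)"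
          by (auto intro!: tendsto_eq_intros)
        ultimately show "((\<lambda>h. norm (g (norm (0 + h)) / norm (0 + h) * (0 + h) $ i
            - g (norm (0::real^'n)) / norm (0::real^'n) * 0 $ i - l * h $ i) / norm h) \<longlongrightarrow> 0) (at 0)"
          by (rule Lim_null_comparison)
      qed
      then show ?thesis using x0 by simp
    qed
  qed
  have hess: "partial_deriv j (partial_deriv i u) x = H i j x" if x: "x \<in> ball 0 \<rho>" for i j x
  proof -
    have "axis j (1::real) $ i = (if i = j then 1 else 0)" by (simp add: axis_def)
    then show ?thesis
      unfolding partial_deriv_eqI[OF second[OF x]] by (auto simp: H_def W_def inner_axis)
  qed
  have H_lip: "\<exists>C. C-lipschitz_on (cball 0 R) (H i j)" if R: "R < \<rho>" for R i j
  proof -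
    obtain L where L: "L-lipschitz_on {0<..R} G" using lip[OF R] by blast
    have L0: "0 \<le> L" by (rule lipschitz_on_nonneg[OF L])
    have origin: "\<bar>H i j x - H i j 0\<bar> \<le> 11 * (L * norm x)" if x: "x \<in> cball 0 R" "x \<noteq> 0" for x
    proof -
      have "\<bar>W i j x\<bar> \<le> L * norm x * 1 * 1"
        unfolding W_def abs_mult using x w_near[OF R L, of "norm x"] component_le_norm_cart[of x]
        by (intro mult_mono) (auto simp: L0)
      moreover have "\<bar>q (norm x) - l\<bar> \<le> L * norm x" using x by (intro q_near[OF R L]) auto
      moreover have "0 \<le> L * norm x" using L0 by simp
      moreover have "H i j x - H i j 0 = (if i = j then q (norm x) - l else 0) + W i j x"
        using x(2) by (simp add: H_def)
      ultimately show ?thesis by (simp split: if_splits)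
    qed
    have apart: "\<bar>H i j x - H i j y\<bar> \<le> 11 * (L * norm (x - y))"
      if x: "x \<in> cball 0 R" "x \<noteq> 0" and y: "y \<in> cball 0 R" "y \<noteq> 0" for x y
    proof -
      have "\<bar>W i j x - W i j y\<bar> \<le> 5 * (2 * L) * norm (x - y)"
        unfolding W_def
      proof (rule lipschitz_direction_product)
        show "\<bar>w (norm x) - w (norm y)\<bar> \<le> 2 * L * \<bar>norm x - norm y\<bar>"
          using x y by (intro w_lip[OF R L]) auto
        show "\<bar>w (norm y)\<bar> \<le> 2 * L * norm y"
          using w_near[OF R L, of "norm y"] y mult_nonneg_nonneg[OF L0 norm_ge_zero[of y]] by auto
      qed (use x y L0 in auto)
      moreover have "\<bar>q (norm x) - q (norm y)\<bar> \<le> L * norm (x - y)"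
      proof (rule order_trans)
        show "\<bar>q (norm x) - q (norm y)\<bar> \<le> L * \<bar>norm x - norm y\<bar>"
          using x y by (intro q_lip[OF R L]) auto
        show "L * \<bar>norm x - norm y\<bar> \<le> L * norm (x - y)"
          by (intro mult_left_mono norm_triangle_ineq3 L0)
      qed
      moreover have "0 \<le> L * norm (x - y)" using L0 by simp
      moreover have "H i j x - H i j y = (if i = j then q (norm x) - q (norm y) else 0) + (W i j x - W i j y)"
        using x(2) y(2) by (simp add: H_def)
      ultimately show ?thesis by (simp split: if_splits)
    qed
    have "(11 * L)-lipschitz_on (cball 0 R) (H i j)"
    proof (rule lipschitz_onI)
      fix x y :: "real^'n" assume "x \<in> cball 0 R" "y \<in> cball 0 R"
      then show "dist (H i j x) (H i j y) \<le> 11 * L * dist x y"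
        using apart[of x y] origin[of x] origin[of y]
        by (cases "x = 0"; cases "y = 0") (auto simp: dist_norm abs_minus_commute)
    qed (use L0 in simp)
    then show ?thesis by blast
  qed
  have "\<exists>C. C-lipschitz_on K (partial_deriv j (partial_deriv i u))"
    if K: "compact K" "K \<subseteq> ball 0 \<rho>" for K i j
  proof -
    obtain R where R: "R < \<rho>" "K \<subseteq> cball 0 R"
      using compact_subset_ball_subset_cball[OF K] .
    obtain C where C: "C-lipschitz_on (cball 0 R) (H i j)" using H_lip[OF R(1)] by blast
    have "C-lipschitz_on K (H i j)" by (rule lipschitz_on_subset[OF C R(2)])
    then have "C-lipschitz_on K (partial_deriv j (partial_deriv i u))"
      by (rule lipschitz_on_transform) (use hess K in auto)
    then show ?thesis ..
  qed
  moreover have "partial_deriv i u differentiable (at x)" if "x \<in> ball 0 \<rho>" for i x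
    using second[OF that] unfolding differentiable_def by blast
  ultimately show ?thesis using u_diff by (simp add: numeral_2_eq_2)
qed

section \<open>The radial Monge--Ampere equation\<close>

lemma norm_axis_real [simp]: "norm (axis j t :: real^'n) = \<bar>t\<bar>"
  by (simp add: norm_eq_sqrt_inner inner_axis axis_nth)

lemma DERIV_along_axis:
  fixes f :: "real^'n \<Rightarrow> real"
  assumes "f differentiable (at (axis j t))"
  shows "DERIV (\<lambda>s. f (axis j s)) t :> partial_deriv j f (axis j t)"
proof -
  let ?D = "frechet_derivative f (at (axis j t))"
  have D: "(f has_derivative ?D) (at (axis j t))"
    using assms by (simp add: frechet_derivative_works)
  have ax: "(\<lambda>s. s *\<^sub>R axis j 1) = (axis j :: real \<Rightarrow> real^'n)"
    by (simp add: fun_eq_iff axis_def vec_eq_iff)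
  have "((\<lambda>s. s *\<^sub>R axis j 1 :: real^'n) has_derivative (\<lambda>h. h *\<^sub>R axis j 1)) (at t)"
    by (rule bounded_linear_imp_has_derivative) (rule bounded_linear_scaleR_left)
  then have "((axis j :: real \<Rightarrow> real^'n) has_derivative (\<lambda>h. h *\<^sub>R axis j 1)) (at t)"
    unfolding ax .
  then have "((\<lambda>s. f (axis j s)) has_derivative (\<lambda>h. ?D (h *\<^sub>R axis j 1))) (at t)"
    using has_derivative_compose D by blast
  moreover have "?D (h *\<^sub>R axis j 1) = partial_deriv j f (axis j t) * h" for h
    using linear_scale[OF has_derivative_linear[OF D]] by (simp add: partial_deriv_def)
  ultimately show ?thesis by (simp add: has_field_derivative_def)
qed

text \<open>
  Away from the origin the chain rule applies, since \<open>\<Phi>\<close> is differentiable as the restriction of \<open>u\<close> to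
  a ray. At the origin the right-hand side is \<open>0\<close> by the convention for division, and the left-hand
  side vanishes because \<open>u\<close> is even.
\<close>

lemma radial_partial_deriv:
  fixes u :: "real^'n \<Rightarrow> real"
  assumes diff: "\<And>x. x \<in> ball 0 \<rho> \<Longrightarrow> u differentiable (at x)"
    and radial: "\<And>x. x \<in> ball 0 \<rho> \<Longrightarrow> u x = \<Phi> (norm x)"
    and x: "x \<in> ball 0 \<rho>"
  shows "partial_deriv i u x = partial_deriv j u (axis j (norm x)) / norm x * x $ i"
proof (cases "x = 0")
  case True
  let ?D = "frechet_derivative u (at 0)"
  have D: "(u has_derivative ?D) (at 0)"
    using diff[of 0] x True by (simp add: frechet_derivative_works)
  have "((\<lambda>y. u (- y)) has_derivative (\<lambda>v. ?D (- v))) (at 0)"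
    by (rule has_derivative_compose[where g = u]) (auto intro!: derivative_eq_intros D)
  then have "(u has_derivative (\<lambda>v. ?D (- v))) (at 0)"
    by (rule has_derivative_transform_within_open[of _ _ _ _ "ball 0 \<rho>"])
      (use x True radial in auto)
  then have "?D (axis i 1) = ?D (- axis i 1)"
    using has_derivative_unique[OF D] by metis
  also have "\<dots> = - ?D (axis i 1)" by (rule linear_neg[OF has_derivative_linear[OF D]])
  finally show ?thesis using True by (simp add: partial_deriv_def)
next
  case False
  define r d where "r = norm x" and "d = partial_deriv j u (axis j r)"
  have r: "0 < r" "r < \<rho>" using False x by (auto simp: r_def)
  have "DERIV (\<lambda>s. u (axis j s)) r :> d"
    unfolding d_def by (rule DERIV_along_axis) (use r diff in simp)
  then have "DERIV \<Phi> r :> d"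
    by (rule has_field_derivative_transform_within_open[of _ _ _ "{0<..<\<rho>}"]) (use r radial in auto)
  moreover have "(norm has_derivative (\<lambda>v. x \<bullet> v / r)) (at x)"
    using has_derivative_norm[OF False]
    by (simp add: r_def sgn_div_norm inner_commute divide_inverse_commute)
  ultimately have "((\<lambda>y. \<Phi> (norm y)) has_derivative (\<lambda>v. d * (x \<bullet> v / r))) (at x)"
    unfolding has_field_derivative_def r_def using has_derivative_compose by blast
  then have "(u has_derivative (\<lambda>v. d * (x \<bullet> v / r))) (at x)"
    by (rule has_derivative_transform_within_open[of _ _ _ _ "ball 0 \<rho>"]) (use x radial in auto)
  then have "partial_deriv i u x = d * (x \<bullet> axis i 1 / r)" by (rule partial_deriv_eqI)
  then show ?thesis by (simp add: inner_axis d_def r_def)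
qed

text \<open>
  Differentiating the gradient along the ray through \<open>x\<close> and along the circle through \<open>x\<close> shows that \<open>x\<close>
  and its rotation \<open>p\<close> by a right angle are eigenvectors of the Hessian, with eigenvalues \<open>g' r\<close> and
  \<open>g r / r\<close>. The differentiability of \<open>g\<close> at \<open>norm x\<close> is part of the conclusion.
\<close>

lemma radial_hessian_det:
  fixes u :: "real^2 \<Rightarrow> real" and g :: "real \<Rightarrow> real"
  assumes grad_u: "\<And>y. y \<in> ball 0 \<rho> \<Longrightarrow> grad u y = (g (norm y) / norm y) *\<^sub>R y"
    and x: "x \<in> ball 0 \<rho>" "x \<noteq> 0" and diff: "grad u differentiable (at x)"
  shows "DERIV (\<lambda>r. (g r)\<^sup>2) (norm x) :> 2 * norm x * det (hessian u x)"
proof -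
  define r where "r = norm x"
  have r: "0 < r" "r < \<rho>" using x by (auto simp: r_def)
  let ?D = "frechet_derivative (grad u) (at x)"
  have D: "(grad u has_derivative ?D) (at x)" using diff unfolding frechet_derivative_works .
  have lin: "linear ?D" by (rule has_derivative_linear[OF D])
  define e where "e = (1 / r) *\<^sub>R x"
  have xe: "x = r *\<^sub>R e" using r by (simp add: e_def)
  have ne: "norm e = 1" using r by (simp add: e_def r_def)
  then have ee: "e \<bullet> e = 1" by (simp add: norm_eq_1)
  have ray: "((\<lambda>t. t *\<^sub>R e) has_derivative (\<lambda>h. h *\<^sub>R e)) (at r)"
    by (rule bounded_linear_imp_has_derivative) (rule bounded_linear_scaleR_left)
  have "((\<lambda>t. grad u (t *\<^sub>R e)) has_derivative (\<lambda>h. ?D (h *\<^sub>R e))) (at r)"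
    by (rule has_derivative_compose[OF ray]) (use D xe in simp)
  then have ray_D: "((\<lambda>t. g t *\<^sub>R e) has_derivative (\<lambda>h. ?D (h *\<^sub>R e))) (at r)"
  proof (rule has_derivative_transform_within_open)
    show "open {0<..<\<rho>}" "r \<in> {0<..<\<rho>}" using r by auto
    show "grad u (t *\<^sub>R e) = g t *\<^sub>R e" if "t \<in> {0<..<\<rho>}" for t
      using grad_u[of "t *\<^sub>R e"] ne that by simp
  qed
  define g' where "g' = ?D e \<bullet> e"
  have D_scale: "?D (h *\<^sub>R v) = h *\<^sub>R ?D v" for h v by (rule linear_scale[OF lin])
  have components: "g t *\<^sub>R e \<bullet> e = g t" "?D (h *\<^sub>R e) \<bullet> e = g' * h" for t h
    by (simp_all add: ee D_scale g'_def)
  have g': "(g has_derivative (\<lambda>h. g' * h)) (at r)"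
    using has_derivative_inner_left[OF ray_D, of e] unfolding components .
  have "?D e = g' *\<^sub>R e"
  proof -
    have "(\<lambda>h. ?D (h *\<^sub>R e)) = (\<lambda>h. (g' * h) *\<^sub>R e)"
      by (rule has_derivative_unique[OF ray_D has_derivative_scaleR_left[OF g']])
    from fun_cong[OF this, of 1] show ?thesis by simp
  qed
  then have "?D (r *\<^sub>R e) = g' *\<^sub>R (r *\<^sub>R e)"
    using D_scale[of r e] by (simp add: mult.commute)
  then have eig1: "?D x = g' *\<^sub>R x" unfolding xe[symmetric] .
  have xx: "x \<bullet> x = r\<^sup>2" by (simp add: r_def power2_norm_eq_inner)
  define p :: "real^2" where "p = vector [- x $ 2, x $ 1]"
  have p: "p $ 1 = - x $ 2" "p $ 2 = x $ 1" by (simp_all add: p_def)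
  have r2: "r\<^sup>2 = (x $ 1)\<^sup>2 + (x $ 2)\<^sup>2"
    using xx by (simp add: inner_vec_def sum_2 power2_eq_square)
  have circle: "norm (cos \<theta> *\<^sub>R x + sin \<theta> *\<^sub>R p) = r" for \<theta>
  proof -
    have "(norm (c *\<^sub>R x + s *\<^sub>R p))\<^sup>2 = (c\<^sup>2 + s\<^sup>2) * r\<^sup>2" for c s
      unfolding power2_norm_eq_inner r2
      by (simp add: inner_vec_def sum_2 p power2_eq_square algebra_simps)
    then have "(norm (cos \<theta> *\<^sub>R x + sin \<theta> *\<^sub>R p))\<^sup>2 = r\<^sup>2" by simp
    then show ?thesis by (rule power2_eq_imp_eq) (use r in auto)
  qed
  have "((\<lambda>\<theta>. cos \<theta> *\<^sub>R x + sin \<theta> *\<^sub>R p) has_derivative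
      (\<lambda>h. (- sin 0 * h) *\<^sub>R x + (cos 0 * h) *\<^sub>R p)) (at 0)"
    by (intro has_derivative_add has_derivative_scaleR_left
        DERIV_cos[unfolded has_field_derivative_def] DERIV_sin[unfolded has_field_derivative_def])
  then have rot: "((\<lambda>\<theta>. cos \<theta> *\<^sub>R x + sin \<theta> *\<^sub>R p) has_derivative (\<lambda>h. h *\<^sub>R p)) (at 0)"
    by simp
  have "((\<lambda>\<theta>. grad u (cos \<theta> *\<^sub>R x + sin \<theta> *\<^sub>R p)) has_derivative (\<lambda>h. ?D (h *\<^sub>R p))) (at 0)"
    by (rule has_derivative_compose[OF rot]) (use D in simp)
  moreover have "grad u (cos \<theta> *\<^sub>R x + sin \<theta> *\<^sub>R p) = (g r / r) *\<^sub>R (cos \<theta> *\<^sub>R x + sin \<theta> *\<^sub>R p)" for \<theta>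
    using grad_u[of "cos \<theta> *\<^sub>R x + sin \<theta> *\<^sub>R p"] circle r by simp
  ultimately have "((\<lambda>\<theta>. (g r / r) *\<^sub>R (cos \<theta> *\<^sub>R x + sin \<theta> *\<^sub>R p)) has_derivative (\<lambda>h. ?D (h *\<^sub>R p))) (at 0)"
    by simp
  moreover have "((\<lambda>\<theta>. (g r / r) *\<^sub>R (cos \<theta> *\<^sub>R x + sin \<theta> *\<^sub>R p)) has_derivative (\<lambda>h. (g r / r) *\<^sub>R h *\<^sub>R p)) (at 0)"
    by (rule has_derivative_scaleR_right[OF rot])
  ultimately have "(\<lambda>h. ?D (h *\<^sub>R p)) = (\<lambda>h. (g r / r) *\<^sub>R h *\<^sub>R p)"
    by (rule has_derivative_unique)
  from fun_cong[OF this, of 1] have eig2: "?D p = (g r / r) *\<^sub>R p" by simp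
  define A where "A = hessian u x"
  have A: "A *v v = ?D v" for v
    unfolding A_def hessian_def by (rule matrix_works) (use lin in \<open>simp add: linear_matrix_vector_mul_eq\<close>)
  have eqs: "A $ 1 $ 1 * x $ 1 + A $ 1 $ 2 * x $ 2 = g' * x $ 1"
    "A $ 2 $ 1 * x $ 1 + A $ 2 $ 2 * x $ 2 = g' * x $ 2"
    "- A $ 1 $ 1 * x $ 2 + A $ 1 $ 2 * x $ 1 = - (g r / r) * x $ 2"
    "- A $ 2 $ 1 * x $ 2 + A $ 2 $ 2 * x $ 1 = (g r / r) * x $ 1"
    using A[of x] A[of p] unfolding eig1 eig2
    by (simp_all add: vec_eq_iff matrix_vector_mult_def sum_2 p forall_2)
  have "det A * r\<^sup>2 = (A $ 1 $ 1 * x $ 1 + A $ 1 $ 2 * x $ 2) * (- A $ 2 $ 1 * x $ 2 + A $ 2 $ 2 * x $ 1)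
      - (A $ 2 $ 1 * x $ 1 + A $ 2 $ 2 * x $ 2) * (- A $ 1 $ 1 * x $ 2 + A $ 1 $ 2 * x $ 1)"
    unfolding det_2 r2 by (simp add: power2_eq_square algebra_simps)
  also have "\<dots> = (g' * (g r / r)) * r\<^sup>2"
    unfolding eqs r2 by (simp add: power2_eq_square algebra_simps)
  finally have "det A = g' * (g r / r)" by (rule mult_right_cancel[THEN iffD1, rotated]) (use r in simp)
  then have "2 * r * det A = 2 * g r * g'" using r by simp
  moreover have "DERIV (\<lambda>r. (g r)\<^sup>2) r :> 2 * g r * g'"
    using g' unfolding has_field_derivative_def[symmetric] by (auto intro!: derivative_eq_intros)
  ultimately show ?thesis by (simp only: A_def r_def)
qed

text \<open>
  An orthogonal map \<open>T\<close> taking \<open>x\<close> to \<open>y\<close> preserves null sets, so \<open>k\<close> and \<open>k \<circ> T\<close> agree off a null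
  set. The set where these continuous functions differ is open and null, hence empty.
\<close>

lemma continuous_radial_off_null:
  fixes k :: "real^'n \<Rightarrow> real" and c :: "real \<Rightarrow> real"
  assumes cont: "continuous_on (ball 0 \<rho>) k" and N: "negligible N"
    and c: "\<And>z. z \<in> ball 0 \<rho> - N \<Longrightarrow> k z = c (norm z)"
    and x: "x \<in> ball 0 \<rho>" and xy: "norm x = norm y"
  shows "k x = k y"
proof (rule ccontr)
  assume ne: "k x \<noteq> k y"
  obtain T where T: "orthogonal_transformation T" "T x = y"
    using orthogonal_transformation_exists[OF xy] .
  have lin: "linear T" and T_norm: "norm (T z) = norm z" for z
    using T(1) by (auto simp: orthogonal_transformation)
  let ?U = "{z \<in> ball 0 \<rho>. k z - k (T z) \<noteq> 0}"
  have "continuous_on (ball 0 \<rho>) (\<lambda>z. k z - k (T z))"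
    by (intro continuous_intros cont continuous_on_compose2[OF cont]
        linear_continuous_on linear_conv_bounded_linear[THEN iffD1] lin) (auto simp: T_norm)
  then have "open ?U"
    using continuous_open_preimage[OF _ open_ball, of 0 \<rho> "\<lambda>z. k z - k (T z)" "- {0}"]
    by (simp add: vimage_def Int_def open_delete Compl_eq_Diff_UNIV)
  moreover have "x \<in> ?U" using x ne T by simp
  moreover have "negligible ?U"
  proof (rule negligible_subset)
    have "negligible (inv T ` N)"
      using negligible_differentiable_image_negligible[OF order_refl N, of "inv T"] T(1)
        linear_imp_differentiable_on orthogonal_transformation_inv orthogonal_transformation_linear
      by blast
    then show "negligible (N \<union> inv T ` N)" using N by simp
    show "?U \<subseteq> N \<union> inv T ` N"
    proof
      fix z assume z: "z \<in> ?U"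
      show "z \<in> N \<union> inv T ` N"
      proof (rule ccontr)
        assume not: "z \<notin> N \<union> inv T ` N"
        have "z = inv T (T z)" using orthogonal_transformation_inj[OF T(1)] by simp
        then have "T z \<notin> N" using not by (metis UnI2 image_eqI)
        then show False using not z c[of z] c[of "T z"] T_norm by auto
      qed
    qed
  qed
  ultimately show False using open_not_negligible by blast
qed

text \<open>
  Consider the map \<open>x \<mapsto> (\<phi> (norm x), x $ 2)\<close> of the punctured disc to the plane. Off \<open>N\<close> its derivative has rank
  at most one, so the image is null by Sard's theorem; the image of \<open>N\<close> is null because the map is
  locally Lipschitz. If \<open>\<phi> a\<close> and \<open>\<phi> b\<close> were different, then by the intermediate value theorem the image
  would contain the rectangle with sides \<open>(\<phi> a, \<phi> b)\<close> and \<open>(0, a)\<close>: for every second coordinate below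
  \<open>a\<close> there are points of each norm in \<open>[a, b]\<close>.
\<close>

lemma constant_of_radial_derivative_zero_ae:
  fixes \<phi> :: "real \<Rightarrow> real" and N :: "(real^2) set"
  assumes N: "negligible N"
    and zero: "\<And>x. x \<in> ball 0 \<rho> - {0} - N \<Longrightarrow> DERIV \<phi> (norm x) :> 0"
    and lip: "\<And>a b. 0 < a \<Longrightarrow> b < \<rho> \<Longrightarrow> \<exists>L. L-lipschitz_on {a..b} \<phi>"
    and ab: "0 < a" "a < b" "b < \<rho>"
  shows "\<phi> a = \<phi> b"
proof (rule ccontr)
  assume ne: "\<phi> a \<noteq> \<phi> b"
  define \<Psi> :: "real^2 \<Rightarrow> real^2" where "\<Psi> x = \<phi> (norm x) *\<^sub>R axis 1 1 + (x $ 2) *\<^sub>R axis 2 1" for x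
  have \<Psi>: "\<Psi> x $ 1 = \<phi> (norm x)" "\<Psi> x $ 2 = x $ 2" for x
    by (simp_all add: \<Psi>_def axis_def)
  let ?B = "ball 0 \<rho> - {0 :: real^2}"
  have "negligible (\<Psi> ` (?B - N))"
  proof (rule baby_Sard[where f' = "\<lambda>x v. (v $ 2) *\<^sub>R axis 2 1"])
    fix x assume x: "x \<in> ?B - N"
    have n: "(norm has_derivative (\<lambda>v. v \<bullet> sgn x)) (at x)"
      by (rule has_derivative_norm) (use x in auto)
    have "(\<phi> has_derivative (\<lambda>h. 0 * h)) (at (norm x))"
      using zero[of x] x unfolding has_field_derivative_def by blast
    note has_derivative_compose[OF n this]
    then have "(\<Psi> has_derivative (\<lambda>v. (0 * (v \<bullet> sgn x)) *\<^sub>R axis 1 1 + (v $ 2) *\<^sub>R axis 2 1)) (at x)"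
      unfolding \<Psi>_def
      by (intro has_derivative_add has_derivative_scaleR_left
          bounded_linear_imp_has_derivative[OF bounded_linear_vec_nth])
    then show "(\<Psi> has_derivative (\<lambda>v. (v $ 2) *\<^sub>R axis 2 1)) (at x within ?B - N)"
      unfolding mult_zero_left scaleR_zero_left add_0_left by (rule has_derivative_at_withinI)
    have "det (matrix (\<lambda>v :: real^2. (v $ 2) *\<^sub>R axis 2 (1::real))) = (0::real)"
      by (simp add: det_2 matrix_def axis_def)
    then show "rank (matrix (\<lambda>v :: real^2. (v $ 2) *\<^sub>R axis 2 (1::real) :: real^2)) < CARD(2)"
      by (rule det_eq_0_rank[THEN iffD1])
  qed simp
  moreover have "negligible (\<Psi> ` (?B \<inter> N))"
  proof (rule negligible_locally_Lipschitz_image)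
    fix x assume x: "x \<in> ?B \<inter> N"
    define s t where "s = norm x / 2" and "t = (norm x + \<rho>) / 2"
    have st: "0 < s" "s < norm x" "norm x < t" "t < \<rho>" using x by (auto simp: s_def t_def)
    obtain L where L: "L-lipschitz_on {s..t} \<phi>" using lip[OF st(1,4)] by blast
    let ?T = "ball 0 t - cball 0 s"
    have "norm (\<Psi> y - \<Psi> x) \<le> (L + 1) * norm (y - x)" if y: "y \<in> ?T" for y
    proof -
      have "\<Psi> y - \<Psi> x = (\<phi> (norm y) - \<phi> (norm x)) *\<^sub>R axis 1 1 + ((y - x) $ 2) *\<^sub>R axis 2 1"
        by (simp add: \<Psi>_def algebra_simps)
      also have "norm \<dots> \<le> \<bar>\<phi> (norm y) - \<phi> (norm x)\<bar> + \<bar>(y - x) $ 2\<bar>"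
        by (rule order_trans[OF norm_triangle_ineq]) simp
      also have "\<dots> \<le> L * norm (y - x) + norm (y - x)"
      proof (rule add_mono[OF _ component_le_norm_cart])
        have "\<bar>\<phi> (norm y) - \<phi> (norm x)\<bar> \<le> L * \<bar>norm y - norm x\<bar>"
          using lipschitz_onD[OF L, of "norm y" "norm x"] y st by (simp add: dist_real_def)
        also have "\<dots> \<le> L * norm (y - x)"
          using lipschitz_on_nonneg[OF L] by (intro mult_left_mono norm_triangle_ineq3)
        finally show "\<bar>\<phi> (norm y) - \<phi> (norm x)\<bar> \<le> L * norm (y - x)" .
      qed
      finally show ?thesis by (simp add: algebra_simps)
    qed
    moreover have "open ?T" "x \<in> ?T" using st by auto
    ultimately show "\<exists>T B. open T \<and> x \<in> T \<and> (\<forall>y\<in>?B \<inter> N \<inter> T. norm (\<Psi> y - \<Psi> x) \<le> B * norm (y - x))"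
      by (intro exI[of _ ?T] exI[of _ "L + 1"]) auto
  qed (use N in \<open>auto intro: negligible_Int\<close>)
  ultimately have "negligible (\<Psi> ` (?B - N) \<union> \<Psi> ` (?B \<inter> N))" by (rule negligible_Un)
  moreover define lo hi where "lo = min (\<phi> a) (\<phi> b)" and "hi = max (\<phi> a) (\<phi> b)"
  define W :: "(real^2) set" where "W = box (vector [lo, 0]) (vector [hi, a])"
  have "W \<subseteq> \<Psi> ` (?B - N) \<union> \<Psi> ` (?B \<inter> N)"
  proof
    fix z assume "z \<in> W"
    then have z: "lo < z $ 1" "z $ 1 < hi" "0 < z $ 2" "z $ 2 < a"
      by (auto simp: W_def mem_box_cart forall_2)
    obtain L where "L-lipschitz_on {a..b} \<phi>" using lip ab by blast
    then have "connected (\<phi> ` {a..b})"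
      by (intro connected_continuous_image lipschitz_on_continuous_on) auto
    moreover have "lo \<in> \<phi> ` {a..b}" "hi \<in> \<phi> ` {a..b}" using ab by (auto simp: lo_def hi_def min_def max_def)
    ultimately have "z $ 1 \<in> \<phi> ` {a..b}"
      by (rule connectedD_interval) (use z in auto)
    then obtain t where t: "a \<le> t" "t \<le> b" "\<phi> t = z $ 1" by auto
    define x :: "real^2" where "x = vector [sqrt (t\<^sup>2 - (z $ 2)\<^sup>2), z $ 2]"
    have "(z $ 2)\<^sup>2 \<le> t\<^sup>2" using z t by (intro power_mono) auto
    then have nx: "norm x = t"
      using t ab by (simp add: norm_vec_def L2_set_def sum_2 x_def)
    then have "\<Psi> x = z" using t by (simp add: vec_eq_iff forall_2 \<Psi>) (simp add: x_def)
    moreover have "x \<in> ?B" using nx t ab by auto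
    ultimately show "z \<in> \<Psi> ` (?B - N) \<union> \<Psi> ` (?B \<inter> N)" by blast
  qed
  ultimately have "negligible W" using negligible_subset by blast
  moreover have "W \<noteq> {}"
    using ne ab by (simp add: W_def interval_ne_empty_cart forall_2 lo_def hi_def)
  moreover have "open W" unfolding W_def by (rule open_box)
  ultimately show False using open_not_negligible by blast
qed

lemma monge_ampere_ae_off_null:
  fixes u k :: "real^2 \<Rightarrow> real"
  assumes "monge_ampere_ae (ball 0 \<rho>) u k"
  obtains N where "negligible N"
    and "\<And>x. x \<in> ball 0 \<rho> - N \<Longrightarrow> grad u differentiable (at x) \<and> det (hessian u x) = k x"
proof -
  have "AE x in lebesgue. x \<in> ball 0 \<rho> \<longrightarrow> grad u differentiable (at x) \<and> det (hessian u x) = k x"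
    using assms unfolding monge_ampere_ae_def by (subst (asm) AE_restrict_space_iff) auto
  then obtain N where "N \<in> null_sets lebesgue"
      "{x \<in> space lebesgue. \<not> (x \<in> ball 0 \<rho> \<longrightarrow> grad u differentiable (at x) \<and> det (hessian u x) = k x)} \<subseteq> N"
    unfolding eventually_ae_filter by blast
  then show thesis using that[of N] by (auto simp: negligible_iff_null_sets)
qed

lemma DERIV_integral_from_0:
  fixes h :: "real \<Rightarrow> real"
  assumes cont: "continuous_on {0..<\<rho>} h" and t: "0 < t" "t < \<rho>"
  shows "DERIV (\<lambda>r. integral {0..r} h) t :> h t"
proof -
  define b where "b = (t + \<rho>) / 2"
  have b: "t < b" "b < \<rho>" using t by (auto simp: b_def)
  have "((\<lambda>r. integral {0..r} h) has_real_derivative h t) (at t within {0..b})"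
    by (rule integral_has_real_derivative) (use b t in \<open>auto intro: continuous_on_subset[OF cont]\<close>)
  then show ?thesis using at_within_Icc_at[of 0 t b] t b by simp
qed

lemma lipschitz_on_Icc_if_DERIV_continuous:
  fixes J h :: "real \<Rightarrow> real"
  assumes der: "\<And>t. t \<in> {a..b} \<Longrightarrow> DERIV J t :> h t" and cont: "continuous_on {a..b} h"
  shows "\<exists>L. L-lipschitz_on {a..b} J"
proof -
  have "bounded (h ` {a..b})" by (intro compact_imp_bounded compact_continuous_image cont) auto
  then obtain C where C: "0 < C" "\<forall>t\<in>{a..b}. norm (h t) \<le> C" unfolding bounded_pos by auto
  have "norm (J s - J t) \<le> C * norm (s - t)" if "s \<in> {a..b}" "t \<in> {a..b}" for s t
    by (rule field_differentiable_bound[of "{a..b}" J h])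
      (use that C der in \<open>auto intro: has_field_derivative_at_within\<close>)
  then have "C-lipschitz_on {a..b} J" using C by (intro lipschitz_onI) (auto simp: dist_norm)
  then show ?thesis ..
qed

lemma lipschitz_on_Icc_power2:
  fixes g :: "real \<Rightarrow> real"
  assumes "L-lipschitz_on {a..b} g"
  shows "\<exists>L. L-lipschitz_on {a..b} (\<lambda>t. (g t)\<^sup>2)"
proof -
  have "bounded (g ` {a..b})"
    by (intro compact_imp_bounded compact_continuous_image lipschitz_on_continuous_on[OF assms]) auto
  then obtain C where C: "0 < C" "\<forall>t\<in>{a..b}. norm (g t) \<le> C" unfolding bounded_pos by auto
  have "dist ((g s)\<^sup>2) ((g t)\<^sup>2) \<le> (2 * C * L) * dist s t" if "s \<in> {a..b}" "t \<in> {a..b}" for s t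
  proof -
    have "\<bar>g s\<bar> \<le> C" "\<bar>g t\<bar> \<le> C" using C(2) that by auto
    then have "\<bar>g s + g t\<bar> \<le> 2 * C" by linarith
    moreover have "\<bar>g s - g t\<bar> \<le> L * dist s t"
      using lipschitz_onD[OF assms that] by (simp add: dist_real_def)
    ultimately have "\<bar>g s + g t\<bar> * \<bar>g s - g t\<bar> \<le> (2 * C) * (L * dist s t)"
      using C by (intro mult_mono) auto
    then show ?thesis
      by (simp add: dist_real_def abs_mult[symmetric] power2_eq_square algebra_simps)
  qed
  then have "(2 * C * L)-lipschitz_on {a..b} (\<lambda>t. (g t)\<^sup>2)"
    using C lipschitz_on_nonneg[OF assms] by (intro lipschitz_onI) auto
  then show ?thesis ..
qed

text \<open>
  The difference of \<open>g\<^sup>2\<close> and the integral of \<open>2 s \<kappa>(s)\<close> has derivative zero at \<open>norm x\<close> for almost every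
  \<open>x\<close>, hence is constant. So \<open>g\<^sup>2\<close> is differentiable at every radius, although the equation is only
  given almost everywhere.
\<close>

lemma radial_monge_ampere_integrated:
  fixes g \<kappa> :: "real \<Rightarrow> real" and N :: "(real^2) set"
  assumes N: "negligible N"
    and eq: "\<And>x. x \<in> ball 0 \<rho> - {0} - N \<Longrightarrow> DERIV (\<lambda>r. (g r)\<^sup>2) (norm x) :> 2 * norm x * \<kappa> (norm x)"
    and \<kappa>: "continuous_on {0..<\<rho>} \<kappa>"
    and lip: "\<And>b. b < \<rho> \<Longrightarrow> \<exists>L. L-lipschitz_on {0..b} g"
    and t: "0 < t" "t < \<rho>"
  shows "DERIV (\<lambda>r. (g r)\<^sup>2) t :> 2 * t * \<kappa> t"
proof -
  define h J where "h s = 2 * s * \<kappa> s" and "J r = integral {0..r} h" for s r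
  have h: "continuous_on {0..<\<rho>} h" unfolding h_def by (intro continuous_intros \<kappa>)
  have J: "DERIV J s :> h s" if "0 < s" "s < \<rho>" for s
    unfolding J_def by (rule DERIV_integral_from_0[OF h that])
  define \<phi> where "\<phi> s = (g s)\<^sup>2 - J s" for s
  have const: "\<phi> a = \<phi> b" if ab: "0 < a" "a < b" "b < \<rho>" for a b
  proof (rule constant_of_radial_derivative_zero_ae[OF N _ _ ab])
    fix x :: "real^2" assume x: "x \<in> ball 0 \<rho> - {0} - N"
    have "DERIV \<phi> (norm x) :> 2 * norm x * \<kappa> (norm x) - h (norm x)"
      unfolding \<phi>_def by (rule DERIV_diff[OF eq[OF x] J]) (use x in auto)
    then show "DERIV \<phi> (norm x) :> 0" by (simp add: h_def)
  next
    fix a b :: real assume ab: "0 < a" "b < \<rho>"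
    obtain L where "L-lipschitz_on {0..b} g" using lip ab by blast
    then have "L-lipschitz_on {a..b} g" by (rule lipschitz_on_subset) (use ab in auto)
    then obtain L1 where L1: "L1-lipschitz_on {a..b} (\<lambda>s. (g s)\<^sup>2)"
      using lipschitz_on_Icc_power2 by blast
    have "\<exists>L. L-lipschitz_on {a..b} J"
      by (rule lipschitz_on_Icc_if_DERIV_continuous[of a b J h])
        (use ab J in \<open>auto intro: continuous_on_subset[OF h]\<close>)
    then obtain L2 where L2: "L2-lipschitz_on {a..b} J" by blast
    show "\<exists>L. L-lipschitz_on {a..b} \<phi>"
      unfolding \<phi>_def using lipschitz_on_diff[OF L1 L2] by blast
  qed
  have same: "J s + \<phi> t = (g s)\<^sup>2" if "s \<in> {0<..<\<rho>}" for s
    using const[of s t] const[of t s] that t by (cases s t rule: linorder_cases) (auto simp: \<phi>_def)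
  have "DERIV (\<lambda>s. J s + \<phi> t) t :> h t"
    using DERIV_add[OF J[OF t] DERIV_const[of "\<phi> t"]] by simp
  then have "DERIV (\<lambda>r. (g r)\<^sup>2) t :> h t"
    by (rule has_field_derivative_transform_within_open[of _ _ _ "{0<..<\<rho>}"]) (use t same in auto)
  then show ?thesis by (simp add: h_def)
qed

section \<open>Regularity of radial solutions\<close>

lemma continuous_on_if_lipschitz_below:
  fixes g :: "real \<Rightarrow> real"
  assumes lip: "\<And>b. b < \<rho> \<Longrightarrow> \<exists>L. L-lipschitz_on {0..b} g"
  shows "continuous_on {0..<\<rho>} g"
  unfolding continuous_on_eq_continuous_within
proof
  fix t assume t: "t \<in> {0..<\<rho>}"
  define b where "b = (t + \<rho>) / 2"
  have b: "t < b" "b < \<rho>" using t by (auto simp: b_def)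
  obtain L where L: "L-lipschitz_on {0..b} g" using lip[OF b(2)] by blast
  have "continuous (at t within {0..b}) g"
    using lipschitz_on_continuous_on[OF L] t b by (auto simp: continuous_on_eq_continuous_within)
  moreover have "at t within {0..b} = at t within {0..<\<rho>}"
    by (rule at_within_nhd[of t "{..<b}"]) (use b in auto)
  ultimately show "continuous (at t within {0..<\<rho>}) g" by simp
qed

text \<open>
  Only the iterated derivatives in one fixed direction matter for the restriction to an axis.
\<close>

lemma Ck_on_funpow_partial_deriv:
  fixes f :: "real^'n \<Rightarrow> real"
  shows "Ck_on n S f \<Longrightarrow> (\<forall>m<n. \<forall>x\<in>S. (partial_deriv i ^^ m) f differentiable (at x)) \<and>
    continuous_on S ((partial_deriv i ^^ n) f)"
proof (induction n arbitrary: f)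
  case (Suc n)
  have IH: "(\<forall>m<n. \<forall>x\<in>S. (partial_deriv i ^^ m) (partial_deriv i f) differentiable (at x)) \<and>
    continuous_on S ((partial_deriv i ^^ n) (partial_deriv i f))"
    by (rule Suc.IH) (use Suc.prems in simp)
  show ?case
  proof (intro conjI allI impI ballI)
    fix m x assume m: "m < Suc n" and x: "x \<in> S"
    show "(partial_deriv i ^^ m) f differentiable (at x)"
    proof (cases m)
      case 0
      then show ?thesis using Suc.prems x by simp
    next
      case (Suc l)
      then show ?thesis using IH m x by (simp add: funpow_Suc_right del: funpow.simps)
    qed
  next
    show "continuous_on S ((partial_deriv i ^^ Suc n) f)"
      using IH by (simp add: funpow_Suc_right del: funpow.simps)
  qed
qed simp

theorem corollary1p3:
  fixes u k :: "real^2 \<Rightarrow> real" and \<rho> :: real and \<Phi> :: "real \<Rightarrow> real"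
  assumes "\<rho> > 0"
    and "Ck1_on 1 (ball 0 \<rho>) u"
    and "convex_on (ball 0 \<rho>) u"
    and "\<And>x. x \<in> ball 0 \<rho> - {0} \<Longrightarrow> k x \<ge> 0"
    and "Ck_on 3 (ball 0 \<rho>) k"
    and "monge_ampere_ae (ball 0 \<rho>) u k"
    and "\<And>x. x \<in> ball 0 \<rho> \<Longrightarrow> u x = \<Phi> (sqrt ((x $ 1)\<^sup>2 + (x $ 2)\<^sup>2))"
  shows "Ck1_on 2 (ball 0 \<rho>) u"
proof -
  let ?B = "ball 0 \<rho> :: (real^2) set"
  have u_diff: "u differentiable (at x)" if "x \<in> ?B" for x using assms(2) that by simp
  have u_lip: "\<exists>L. L-lipschitz_on K (partial_deriv i u)" if "compact K" "K \<subseteq> ?B" for K i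
    using assms(2) that by simp
  have radial: "u x = \<Phi> (norm x)" if "x \<in> ?B" for x
    using assms(7)[OF that] by (simp add: norm_vec_def L2_set_def sum_2)
  define g where "g r = partial_deriv 1 u (axis 1 r)" for r
  have pd_u: "partial_deriv i u x = g (norm x) / norm x * x $ i" if "x \<in> ?B" for i x
    unfolding g_def by (rule radial_partial_deriv[OF u_diff radial that])
  then have grad_u: "grad u x = (g (norm x) / norm x) *\<^sub>R x" if "x \<in> ?B" for x
    using that by (simp add: grad_def vec_eq_iff)
  have axis0: "axis 1 0 = (0 :: real^2)" by (simp add: axis_def vec_eq_iff)
  have g0: "g 0 = 0" using pd_u[of 0 1] assms(1) by (simp add: g_def axis0)
  have g_lip: "\<exists>L. L-lipschitz_on {0..b} g" if b: "b < \<rho>" for b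
  proof -
    have "cball 0 b \<subseteq> ?B" using b by auto
    then obtain L where L: "L-lipschitz_on (cball 0 b) (partial_deriv 1 u)"
      using u_lip[OF compact_cball] by blast
    have "L-lipschitz_on {0..b} g"
    proof (rule lipschitz_onI)
      fix s t assume st: "s \<in> {0..b}" "t \<in> {0..b}"
      have "axis 1 s - axis 1 t = (axis 1 (s - t) :: real^2)" by (simp add: axis_def vec_eq_iff)
      then have "dist (axis 1 s) (axis 1 t :: real^2) = dist s t"
        by (simp add: dist_norm)
      then show "dist (g s) (g t) \<le> L * dist s t"
        using lipschitz_onD[OF L, of "axis 1 s" "axis 1 t"] st by (simp add: g_def)
    qed (rule lipschitz_on_nonneg[OF L])
    then show ?thesis ..
  qed
  have g_cont: "continuous_on {0..<\<rho>} g" by (rule continuous_on_if_lipschitz_below[OF g_lip])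
  define K where "K m t = (partial_deriv 1 ^^ m) k (axis 1 t)" for m t
  note k_derivs = Ck_on_funpow_partial_deriv[OF assms(5), of 1]
  have k_diff: "(partial_deriv 1 ^^ m) k differentiable (at x)" if "m < 3" "x \<in> ?B" for m x
    using k_derivs that by blast
  have K_der: "DERIV (K m) t :> K (Suc m) t" if "m < 3" "\<bar>t\<bar> < \<rho>" for m t
    using DERIV_along_axis[OF k_diff[of m "axis 1 t"]] that by (simp add: K_def[abs_def])
  have axis_cont: "continuous_on S (axis 1 :: real \<Rightarrow> real^2)" for S
    unfolding axis_def
  proof (rule continuous_on_vec_lambda)
    show "continuous_on S (\<lambda>x. if i = 1 then x else 0)" for i :: 2
      by (cases "i = 1") (simp_all add: continuous_on_id)
  qed
  have K3: "continuous_on {-\<rho><..<\<rho>} (K 3)"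
    unfolding K_def[abs_def] by (rule continuous_on_compose2[OF k_derivs[THEN conjunct2] axis_cont]) auto
  have K0_cont: "continuous_on {-\<rho><..<\<rho>} (K 0)"
    by (rule DERIV_continuous_on[of _ _ "K 1"])
      (use K_der[of 0] in \<open>auto intro: has_field_derivative_at_within\<close>)
  have nonneg: "0 \<le> K 0 t" if "\<bar>t\<bar> < \<rho>" for t
  proof (cases "t = 0")
    case False
    then have "axis 1 t \<in> ?B - {0}" using that by simp
    then show ?thesis using assms(4) by (simp add: K_def)
  next
    case True
    have "isCont (K 0) 0"
      using K0_cont assms(1) by (simp add: continuous_on_eq_continuous_at)
    then have "(K 0 \<longlongrightarrow> K 0 0) (at_right 0)"
      by (simp add: continuous_at filterlim_at_split)
    moreover have "\<forall>\<^sub>F s in at_right 0. 0 \<le> K 0 s"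
      using eventually_at_right_real[OF assms(1)]
    proof eventually_elim
      case (elim s)
      then have "axis 1 s \<in> ?B - {0}" by simp
      then show ?case using assms(4) by (simp add: K_def)
    qed
    ultimately have "0 \<le> K 0 0" by (rule tendsto_lowerbound) simp
    then show ?thesis using True by simp
  qed
  obtain N0 where N0: "negligible N0"
    and good: "\<And>x. x \<in> ?B - N0 \<Longrightarrow> grad u differentiable (at x) \<and> det (hessian u x) = k x"
    using monge_ampere_ae_off_null[OF assms(6)] by metis
  \<comment> \<open>The Hessian formula needs a direction, so the origin is added to the exceptional set.\<close>
  define N where "N = insert 0 N0"
  have N: "negligible N" using N0 by (simp add: N_def negligible_insert)
  have eq_k: "DERIV (\<lambda>r. (g r)\<^sup>2) (norm x) :> 2 * norm x * k x" if x: "x \<in> ?B - N" for x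
    using radial_hessian_det[OF grad_u, of \<rho> x] good[of x] x by (auto simp: N_def)
  have k_radial: "k x = K 0 (norm x)" if x: "x \<in> ?B" for x
  proof -
    have "k x = k (axis 1 (norm x))"
    \<comment> \<open>Off \<open>N\<close> the equation expresses \<open>k\<close> through the derivative of \<open>g\<^sup>2\<close>, which depends only on the norm.\<close>
    proof (rule continuous_radial_off_null[OF _ N _ x])
      show "continuous_on ?B k"
        using k_diff[of 0] by (intro differentiable_imp_continuous_on)
          (auto simp: differentiable_on_def intro: differentiable_at_withinI)
      show "k z = deriv (\<lambda>r. (g r)\<^sup>2) (norm z) / (2 * norm z)" if z: "z \<in> ?B - N" for z
        using DERIV_imp_deriv[OF eq_k[OF z]] z by (auto simp: N_def)
    qed simp
    then show ?thesis by (simp add: K_def)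
  qed
  have der: "DERIV (\<lambda>r. (g r)\<^sup>2) t :> 2 * t * K 0 t" if t: "0 < t" "t < \<rho>" for t
  proof (rule radial_monge_ampere_integrated[OF N _ _ g_lip t])
    show "DERIV (\<lambda>r. (g r)\<^sup>2) (norm x) :> 2 * norm x * K 0 (norm x)" if "x \<in> ?B - {0} - N" for x
      using eq_k[of x] k_radial[of x] that by auto
    show "continuous_on {0..<\<rho>} (K 0)" by (rule continuous_on_subset[OF K0_cont]) (use assms(1) in auto)
  qed
  obtain G where "\<And>t. 0 < t \<Longrightarrow> t < \<rho> \<Longrightarrow> DERIV g t :> G t"
    and "\<And>R. R < \<rho> \<Longrightarrow> \<exists>L. L-lipschitz_on {0<..R} G"
    using root_of_radial_integral_C11[OF assms(1) K_der K3 nonneg g0 g_cont der] by blast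
  then show ?thesis
    by (intro radial_profile_Ck1[OF assms(1) u_diff pd_u g0 g_cont])
qed

end
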